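(* Let $E$ be a JB$^*$-triple and let $T:E\to E$ be a bounded local triple derivation on $E$. Then $T$ is a triple derivation on $E$.
   Context: A JB$^*$-triple is a complex Banach space $E$ with a continuous triple product $\{\cdot,\cdot,\cdot\}:E\times E\times E\to E$ which is conjugate linear in the middle variable and symmetric and bilinear in the outer variables, such that: (a) $\{a,b,\{x,y,z\}\}=\{\{a,b,x\},y,z\}-\{x,\{b,a,y\},z\}+\{x,y,\{a,b,z\}\}$ for all $a,b,x,y,z\in E$; (b) for each $a\in E$ the operator $L(a,a):x\mapsto\{a,a,x\}$ is a hermitian operator with non-negative spectrum; (c) $\|\{a,a,a\}\|=\|a\|^3$ for all $a\in E$. A triple derivation on $E$ is a linear map $\delta:E\to E$ with $\delta\{a,b,c\}=\{\delta(a),b,c\}+\{a,\delta(b),c\}+\{a,b,\delta(c)\}$ for all $a,b,c\in E$. A local triple derivation on $E$ is a linear map $T:E\to E$ such that for each $a\in E$ there exists a triple derivation $\delta_a$ on $E$ with $T(a)=\delta_a(a)$. *)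

theory Defs
  imports "HOL-Analysis.Analysis"
begin

text \<open>
  The real vector space structure, the norm and completeness come from the class
  \<^class>\<open>banach\<close>; the complex structure is an explicit scalar multiplication extending the
  real one.
\<close>

locale complex_banach = vector_space scaleC
  for scaleC :: "complex \<Rightarrow> 'a::banach \<Rightarrow> 'a" (infixr \<open>*\<^sub>C\<close> 75) +
  assumes scaleC_of_real: "complex_of_real r *\<^sub>C x = r *\<^sub>R x"
    and norm_scaleC: "norm (c *\<^sub>C x) = cmod c * norm x"

definition bounded_clinear ::
    "(complex \<Rightarrow> 'a::banach \<Rightarrow> 'a) \<Rightarrow> ('a \<Rightarrow> 'a) \<Rightarrow> bool" where
  "bounded_clinear scaleC A \<longleftrightarrow> Vector_Spaces.linear scaleC scaleC A \<and> bounded_linear A"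

text \<open>
  The exponential series of an operator, evaluated pointwise; for bounded \<open>A\<close> it converges
  absolutely at every point, and its sum is the exponential of \<open>A\<close> in the Banach algebra of
  bounded operators.
\<close>

definition exp_operator :: "('a::banach \<Rightarrow> 'a) \<Rightarrow> 'a \<Rightarrow> 'a" where
  "exp_operator A x = (\<Sum>n. (A ^^ n) x /\<^sub>R fact n)"

text \<open>
  A bounded operator \<open>A\<close> is hermitian if \<open>exp (i t A)\<close> is an isometry for every real \<open>t\<close>.
  As the inverse of \<open>exp (i t A)\<close> is \<open>exp (- i t A)\<close>, on a nonzero space this says that all
  these exponentials have operator norm 1.
\<close>

definition hermitian_operator ::
    "(complex \<Rightarrow> 'a::banach \<Rightarrow> 'a) \<Rightarrow> ('a \<Rightarrow> 'a) \<Rightarrow> bool" where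
  "hermitian_operator scaleC A \<longleftrightarrow> bounded_clinear scaleC A \<and>
    (\<forall>t::real. \<forall>x. norm (exp_operator (\<lambda>y. scaleC (\<i> * complex_of_real t) (A y)) x) = norm x)"

definition operator_spectrum ::
    "(complex \<Rightarrow> 'a::banach \<Rightarrow> 'a) \<Rightarrow> ('a \<Rightarrow> 'a) \<Rightarrow> complex set" where
  "operator_spectrum scaleC A =
    {z. \<not> (\<exists>B. bounded_clinear scaleC B \<and>
              (\<forall>x. B (A x - scaleC z x) = x) \<and> (\<forall>x. A (B x) - scaleC z (B x) = x))}"

text \<open>Linearity of the triple product in the third variable follows from \<open>triple_commute\<close>.\<close>

locale jb_star_triple = complex_banach scaleC
  for scaleC :: "complex \<Rightarrow> 'a::banach \<Rightarrow> 'a" (infixr \<open>*\<^sub>C\<close> 75) +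
  fixes triple :: "'a \<Rightarrow> 'a \<Rightarrow> 'a \<Rightarrow> 'a"
  assumes triple_continuous: "continuous_on UNIV (\<lambda>(x, y, z). triple x y z)"
    and triple_commute: "triple x y z = triple z y x"
    and triple_add_left: "triple (x + x') y z = triple x y z + triple x' y z"
    and triple_scale_left: "triple (c *\<^sub>C x) y z = c *\<^sub>C triple x y z"
    and triple_add_middle: "triple x (y + y') z = triple x y z + triple x y' z"
    and triple_scale_middle: "triple x (c *\<^sub>C y) z = cnj c *\<^sub>C triple x y z"
    and jordan_identity:
      "triple a b (triple x y z) =
        triple (triple a b x) y z - triple x (triple b a y) z + triple x y (triple a b z)"
    and hermitian: "hermitian_operator scaleC (triple a a)"
    and nonneg_spectrum: "operator_spectrum scaleC (triple a a) \<subseteq> \<real>\<^sub>\<ge>\<^sub>0"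
    and norm_cube: "norm (triple a a a) = norm a ^ 3"

definition triple_derivation ::
    "(complex \<Rightarrow> 'a::banach \<Rightarrow> 'a) \<Rightarrow> ('a \<Rightarrow> 'a \<Rightarrow> 'a \<Rightarrow> 'a) \<Rightarrow> ('a \<Rightarrow> 'a) \<Rightarrow> bool" where
  "triple_derivation scaleC triple \<delta> \<longleftrightarrow> Vector_Spaces.linear scaleC scaleC \<delta> \<and>
    (\<forall>a b c. \<delta> (triple a b c) = triple (\<delta> a) b c + triple a (\<delta> b) c + triple a b (\<delta> c))"

definition local_triple_derivation ::
    "(complex \<Rightarrow> 'a::banach \<Rightarrow> 'a) \<Rightarrow> ('a \<Rightarrow> 'a \<Rightarrow> 'a \<Rightarrow> 'a) \<Rightarrow> ('a \<Rightarrow> 'a) \<Rightarrow> bool" where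
  "local_triple_derivation scaleC triple T \<longleftrightarrow> Vector_Spaces.linear scaleC scaleC T \<and>
    (\<forall>a. \<exists>\<delta>. triple_derivation scaleC triple \<delta> \<and> T a = \<delta> a)"

end

theory Submission
  imports Defs "HOL-Complex_Analysis.Conformal_Mappings"
begin

text \<open>
  Why a bounded local triple derivation \<open>T\<close> is a triple derivation: it generates a one-parameter
  group of isometries, and by Kaup's theorem the surjective linear isometries of a JB*-triple are
  triple automorphisms; differentiating the group at time 0 gives the Leibniz rule for \<open>T\<close>.

  Everything is expressed through the complex functionals \<open>\<phi>\<close> of norm at most 1 with
  \<open>\<phi> z = \<parallel>z\<parallel>\<close>, the functionals supporting at \<open>z\<close>. We write \<open>L(a, b) x = {a, b, x}\<close> for the box operators,
  \<open>Q(z) x = {z, x, z}\<close>, and \<open>z\<^sub>n = L(z, z)\<^sup>n z\<close> for the odd power \<open>z\<^sup>2\<^sup>n\<^sup>+\<^sup>1\<close>. The key to both parts is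
  the identity \<open>\<phi> {z, a, z} = \<parallel>z\<parallel>\<^sup>2 cnj (\<phi> a)\<close> for all \<open>a\<close> and all \<open>\<phi>\<close> supporting at \<open>z\<close>
  (\<open>supports_quadratic\<close>). It says that the vector field \<open>\<parallel>z\<parallel>\<^sup>2 a - {z, a, z}\<close> is tangent to all spheres
  about the origin. For a tangential field one good supporting functional at each point is enough
  (\<open>inward_for_all_supports\<close>), and for a unit vector \<open>z\<close> such a functional, one with
  \<open>\<phi> \<circ> L(z, z) = \<phi>\<close>, is found as follows.

  By a maximum principle argument for resolvents, a hermitian operator with non-negative spectrum
  has non-negative numerical range (\<open>nonneg_numerical_range\<close>). For \<open>\<parallel>z\<parallel> \<le> 1\<close> the powers of \<open>L(z, z)\<close> are
  bounded by an addition theorem for the operators \<open>L(z\<^sub>n, z)\<close> (\<open>box_power_bounded\<close>), so \<open>1 - L(z, z)\<close> is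
  positive as well (\<open>box_le\<close>). Comparing \<open>L(y, y)\<close> with \<open>L(z\<^sup>3, z\<^sup>3)\<close> for \<open>y = (z + z\<^sup>5) / 2\<close> gives
  \<open>\<parallel>y\<parallel> \<ge> 1\<close> when \<open>\<parallel>z\<parallel> = 1\<close>, hence a \<open>\<phi>\<close> with \<open>\<phi> z = \<phi> z\<^sup>5 = 1\<close> (\<open>ex_supports_fifth_power\<close>). The
  Cauchy--Schwarz inequality for the positive form \<open>\<phi> {a, b, z}\<close> shows that \<open>\<phi> \<circ> L(z, z)\<close> is invariant
  under \<open>L(z, z)\<close>, and it is the required functional (\<open>ex_invariant_supports\<close>).

  First consequence: if \<open>\<phi>\<close> supports at a unit vector \<open>u\<close> and \<open>\<delta>\<close> is any triple derivation,
  then \<open>\<phi> (\<delta> u\<^sub>n) = (n + 1) \<phi> (\<delta> u) + n cnj (\<phi> (\<delta> u))\<close>. Applying this to the derivations that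
  agree with \<open>T\<close> at suitable combinations of odd powers of \<open>u\<close> yields \<open>Re (\<phi> (T u)) = 0\<close>
  (\<open>local_triple_derivation_skew\<close>); the detour through odd powers replaces a norm bound for these
  derivations, which vary with the point and could be discontinuous. This makes the flow of \<open>T\<close> isometric (\<open>flow_contractive\<close>).

  Second consequence, Kaup's theorem: for an isometry \<open>U\<close> with inverse \<open>V\<close> the quadratic field
  \<open>U {V z, a, V z} - {z, U a, z}\<close> is annihilated by all functionals supporting at \<open>z\<close>, and a quadratic
  field with this property is zero (\<open>tangential_quadratic_zero\<close>), an instance of Cartan's uniqueness
  principle.
\<close>

section \<open>The Hahn--Banach theorem\<close>

definition sublinear :: "('a::real_vector \<Rightarrow> real) \<Rightarrow> bool" where
  "sublinear p \<longleftrightarrow> (\<forall>x y. p (x + y) \<le> p x + p y) \<and> (\<forall>r x. 0 \<le> r \<longrightarrow> p (r *\<^sub>R x) = r * p x)"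

lemma sublinear_add: "sublinear p \<Longrightarrow> p (x + y) \<le> p x + p y"
  and sublinear_scale: "sublinear p \<Longrightarrow> 0 \<le> r \<Longrightarrow> p (r *\<^sub>R x) = r * p x"
  by (auto simp: sublinear_def)

lemma sublinear_zero: "sublinear p \<Longrightarrow> p 0 = 0"
  using sublinear_scale[of p 0 0] by simp

lemma sublinear_ge_neg: "sublinear p \<Longrightarrow> - p (- x) \<le> p x"
  using sublinear_add[of p x "- x"] sublinear_zero[of p] by simp

text \<open>Moving a sublinear functional down in the direction of \<open>x\<close> makes it linear on the line
  through \<open>x\<close>; both the minimality argument and the choice of the value at a given vector rest on
  this construction.\<close>

lemma sublinear_lower_along:
  fixes p :: "'a::real_vector \<Rightarrow> real"
  assumes p: "sublinear p"
  obtains q where "sublinear q" "\<And>y. q y \<le> p y" "q (- x) \<le> - p x"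
proof -
  define S where "S y = (\<lambda>t. p (y + t *\<^sub>R x) - t * p x) ` {0..}" for y
  define q where "q y = Inf (S y)" for y
  have lower: "- p (- y) \<le> s" if s: "s \<in> S y" for s y
  proof -
    obtain t where t: "0 \<le> t" "s = p (y + t *\<^sub>R x) - t * p x"
      using s by (auto simp: S_def)
    have "t * p x = p ((y + t *\<^sub>R x) + - y)"
      using sublinear_scale[OF p t(1), of x] by simp
    also have "\<dots> \<le> p (y + t *\<^sub>R x) + p (- y)"
      by (rule sublinear_add[OF p])
    finally show ?thesis using t(2) by simp
  qed
  then have bdd: "bdd_below (S y)" for y
    by (meson bdd_below.I)
  have le: "q y \<le> p (y + t *\<^sub>R x) - t * p x" if "0 \<le> t" for y t
    unfolding q_def by (rule cInf_lower[OF _ bdd]) (use that in \<open>auto simp: S_def\<close>)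
  have ge: "c \<le> q y" if "\<And>t. 0 \<le> t \<Longrightarrow> c \<le> p (y + t *\<^sub>R x) - t * p x" for c y
    unfolding q_def by (rule cInf_greatest) (use that in \<open>auto simp: S_def\<close>)
  have "q (y + y') \<le> q y + q y'" for y y'
  proof -
    have "q (y + y') - q y \<le> p (y' + t' *\<^sub>R x) - t' * p x" if t': "0 \<le> t'" for t'
    proof -
      have "q (y + y') - (p (y' + t' *\<^sub>R x) - t' * p x) \<le> p (y + t *\<^sub>R x) - t * p x"
        if t: "0 \<le> t" for t
      proof -
        have "q (y + y') \<le> p ((y + t *\<^sub>R x) + (y' + t' *\<^sub>R x)) - (t + t') * p x"
          using le[of "t + t'" "y + y'"] t t' by (simp add: algebra_simps)
        also have "\<dots> \<le> p (y + t *\<^sub>R x) + p (y' + t' *\<^sub>R x) - (t + t') * p x"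
          using sublinear_add[OF p] by simp
        finally show ?thesis by (simp add: algebra_simps)
      qed
      from ge[OF this] show ?thesis by simp
    qed
    from ge[OF this] show ?thesis by simp
  qed
  moreover have "q (r *\<^sub>R y) = r * q y" if r: "0 \<le> r" for r y
  proof (cases "r = 0")
    case True
    have "q 0 \<le> 0" using le[of 0 0] sublinear_zero[OF p] by simp
    moreover have "0 \<le> q 0"
      by (rule ge) (simp add: sublinear_scale[OF p])
    ultimately show ?thesis using True by simp
  next
    case False
    with r have r: "0 < r" by simp
    have scaled: "s * q y \<le> q (s *\<^sub>R y)" if s: "0 < s" for s y
    proof (rule ge)
      fix t :: real assume t: "0 \<le> t"
      have "s * q y \<le> s * (p (y + (t / s) *\<^sub>R x) - (t / s) * p x)"
        using le[of "t / s" y] s t by (intro mult_left_mono) auto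
      also have "\<dots> = p (s *\<^sub>R (y + (t / s) *\<^sub>R x)) - t * p x"
        using s by (simp only: sublinear_scale[OF p less_imp_le[OF s]]) (simp add: field_simps)
      also have "s *\<^sub>R (y + (t / s) *\<^sub>R x) = s *\<^sub>R y + t *\<^sub>R x"
        using s by (simp add: scaleR_right_distrib)
      finally show "s * q y \<le> p (s *\<^sub>R y + t *\<^sub>R x) - t * p x" .
    qed
    have "inverse r * q (r *\<^sub>R y) \<le> q y"
      using scaled[of "inverse r" "r *\<^sub>R y"] r by simp
    then have "q (r *\<^sub>R y) \<le> r * q y"
      using r by (simp add: field_simps)
    with scaled[OF r, of y] show ?thesis by simp
  qed
  ultimately have "sublinear q" by (auto simp: sublinear_def)
  moreover have "q y \<le> p y" for y using le[of 0 y] by simp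
  moreover have "q (- x) \<le> - p x"
    using le[of 1 "- x"] sublinear_zero[OF p] by simp
  ultimately show thesis by (rule that)
qed

text \<open>The Hahn--Banach theorem in the form: a minimal sublinear functional is linear, because the
  previous construction cannot lower it any further.\<close>

theorem ex_linear_below_sublinear:
  fixes p :: "'a::real_vector \<Rightarrow> real"
  assumes p: "sublinear p"
  obtains f where "linear f" "\<And>x. f x \<le> p x"
proof -
  define A where "A = {g. sublinear g \<and> g \<le> p}"
  have "\<exists>m\<in>A. \<forall>a\<in>A. a \<le> m \<longrightarrow> a = m"
  proof (rule predicate_Zorn[where P = "\<lambda>a b. b \<le> a"])
    show "partial_order_on A (relation_of (\<lambda>a b. b \<le> a) A)"
      by (rule partial_order_on_relation_ofI) auto
  next
    fix C assume C: "C \<in> Chains (relation_of (\<lambda>a b. b \<le> a) A)"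
    have CA: "g \<in> A" if "g \<in> C" for g
      using C that by (auto simp: Chains_def relation_of_def)
    have chain: "g \<le> h \<or> h \<le> g" if "g \<in> C" "h \<in> C" for g h
      using C that by (auto simp: Chains_def relation_of_def)
    show "\<exists>u\<in>A. \<forall>a\<in>C. u \<le> a"
    proof (cases "C = {}")
      case True
      then show ?thesis using p by (auto simp: A_def)
    next
      case False
      define u where "u x = Inf ((\<lambda>g. g x) ` C)" for x
      have sub: "sublinear g" and gp: "g x \<le> p x" if "g \<in> C" for g x
        using CA[OF that] by (auto simp: A_def le_fun_def)
      have bdd: "bdd_below ((\<lambda>g. g x) ` C)" for x
      proof (rule bdd_belowI[of _ "- p (- x)"])
        fix r assume "r \<in> (\<lambda>g. g x) ` C"
        then obtain g where g: "g \<in> C" "r = g x" by auto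
        show "- p (- x) \<le> r"
          using sublinear_ge_neg[OF sub[OF g(1)], of x] gp[OF g(1), of "- x"] g(2) by linarith
      qed
      have le: "u x \<le> g x" if "g \<in> C" for g x
        unfolding u_def by (rule cInf_lower[OF _ bdd]) (use that in auto)
      have ge: "c \<le> u x" if "\<And>g. g \<in> C \<Longrightarrow> c \<le> g x" for c x
        unfolding u_def by (rule cInf_greatest) (use that False in auto)
      have "u (x + y) \<le> u x + u y" for x y
      proof -
        have "u (x + y) - u x \<le> h y" if h: "h \<in> C" for h
        proof -
          have "u (x + y) - h y \<le> g x" if g: "g \<in> C" for g
          proof -
            obtain k where k: "k \<in> C" "k \<le> g" "k \<le> h" using chain[OF g h] g h by auto
            have "u (x + y) \<le> k x + k y"
              using le[OF k(1), of "x + y"] sublinear_add[OF sub[OF k(1)], of x y] by linarith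
            then show ?thesis
              using le_funD[OF k(2), of x] le_funD[OF k(3), of y] by linarith
          qed
          then have "u (x + y) - h y \<le> u x" by (rule ge)
          then show ?thesis by simp
        qed
        then have "u (x + y) - u x \<le> u y" by (rule ge)
        then show ?thesis by simp
      qed
      moreover have "u (r *\<^sub>R x) = r * u x" if r: "0 \<le> r" for r x
      proof (rule antisym)
        show "r * u x \<le> u (r *\<^sub>R x)"
          by (rule ge) (use r le in \<open>auto simp: sublinear_scale[OF sub] intro: mult_left_mono\<close>)
        show "u (r *\<^sub>R x) \<le> r * u x"
        proof (cases "r = 0")
          case True
          obtain g where g: "g \<in> C" using False by auto
          show ?thesis using True le[OF g, of 0] sublinear_zero[OF sub[OF g]] by simp
        next
          case neq: False
          have "u (r *\<^sub>R x) / r \<le> u x"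
          proof (rule ge)
            fix g assume g: "g \<in> C"
            show "u (r *\<^sub>R x) / r \<le> g x"
              using le[OF g, of "r *\<^sub>R x"] sublinear_scale[OF sub[OF g] r, of x] r neq
              by (simp add: field_simps)
          qed
          then show ?thesis using r neq by (simp add: field_simps)
        qed
      qed
      ultimately have "sublinear u" by (auto simp: sublinear_def)
      moreover have "u \<le> p"
        using False le gp by (meson all_not_in_conv le_funI order_trans)
      ultimately show ?thesis using le by (auto simp: A_def le_fun_def)
    qed
  qed
  then obtain m where m: "sublinear m" "m \<le> p"
    and min: "\<And>g. sublinear g \<Longrightarrow> g \<le> p \<Longrightarrow> g \<le> m \<Longrightarrow> g = m"
    by (auto simp: A_def)
  have neg: "m (- x) = - m x" for x
  proof -
    obtain q where q: "sublinear q" "\<And>y. q y \<le> m y" "q (- x) \<le> - m x"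
      using sublinear_lower_along[OF m(1), of x] by blast
    have "q \<le> m" using q(2) by (simp add: le_fun_def)
    then have "q = m" using min[OF q(1)] m(2) by (meson order_trans)
    then show ?thesis
      using q(3) sublinear_ge_neg[OF m(1), of x] by simp
  qed
  have "linear m"
  proof (rule linearI)
    show "m (x + y) = m x + m y" for x y
    proof (rule antisym)
      show "m (x + y) \<le> m x + m y" by (rule sublinear_add[OF m(1)])
      show "m x + m y \<le> m (x + y)"
        using sublinear_add[OF m(1), of "- x" "- y"] neg[of x] neg[of y] neg[of "x + y"] by simp
    qed
    show "m (r *\<^sub>R x) = r *\<^sub>R m x" for r x
    proof (cases "0 \<le> r")
      case True
      then show ?thesis using sublinear_scale[OF m(1)] by simp
    next
      case False
      then have "m ((- r) *\<^sub>R x) = (- r) * m x"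
        using sublinear_scale[OF m(1), of "- r"] by simp
      then show ?thesis using neg[of "r *\<^sub>R x"] by simp
    qed
  qed
  then show thesis using that m(2) by (auto simp: le_fun_def)
qed

lemma ex_norming_linear:
  fixes z :: "'a::real_normed_vector"
  obtains f where "linear f" "\<And>x. f x \<le> norm x" "f z = norm z"
proof -
  have "sublinear (norm :: 'a \<Rightarrow> real)"
    by (auto simp: sublinear_def norm_triangle_ineq)
  then obtain q where q: "sublinear q" "\<And>y. q y \<le> norm y" "q (- z) \<le> - norm z"
    using sublinear_lower_along[where x = z] by blast
  obtain f where f: "linear f" "\<And>x. f x \<le> q x"
    using ex_linear_below_sublinear[OF q(1)] by blast
  have "f z = norm z"
    using f(2)[of "- z"] q(3) f(2)[of z] q(2)[of z] linear_neg[OF f(1), of z] by simp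
  moreover have "f x \<le> norm x" for x using f(2)[of x] q(2)[of x] by simp
  ultimately show thesis using that f(1) by blast
qed

section \<open>Supporting functionals\<close>

context complex_banach
begin

lemma scaleR_eq_scaleC: "r *\<^sub>R x = complex_of_real r *\<^sub>C x"
  by (simp add: scaleC_of_real)

text \<open>The functionals of norm at most 1 that attain the norm at \<open>z\<close>. Dissipativity, positivity and
  tangency of vector fields are all expressed through them; at \<open>z = 0\<close> every functional of norm at
  most 1 is admitted.\<close>

definition supports :: "('a \<Rightarrow> complex) \<Rightarrow> 'a \<Rightarrow> bool" where
  "supports \<phi> z \<longleftrightarrow> (\<forall>x y. \<phi> (x + y) = \<phi> x + \<phi> y) \<and> (\<forall>c x. \<phi> (c *\<^sub>C x) = c * \<phi> x) \<and>
    (\<forall>x. cmod (\<phi> x) \<le> norm x) \<and> \<phi> z = of_real (norm z)"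

lemma supports_add: "supports \<phi> z \<Longrightarrow> \<phi> (x + y) = \<phi> x + \<phi> y"
  and supports_scaleC: "supports \<phi> z \<Longrightarrow> \<phi> (c *\<^sub>C x) = c * \<phi> x"
  and supports_bound: "supports \<phi> z \<Longrightarrow> cmod (\<phi> x) \<le> norm x"
  and supports_self: "supports \<phi> z \<Longrightarrow> \<phi> z = of_real (norm z)"
  by (auto simp: supports_def)

lemma supports_scaleR: "supports \<phi> z \<Longrightarrow> \<phi> (r *\<^sub>R x) = of_real r * \<phi> x"
  by (simp add: scaleR_eq_scaleC supports_scaleC)

lemma supports_zero: "supports \<phi> z \<Longrightarrow> \<phi> 0 = 0"
  using supports_scaleC[of \<phi> z 0 0] by simp

lemma supports_minus: "supports \<phi> z \<Longrightarrow> \<phi> (- x) = - \<phi> x"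
  using supports_scaleR[of \<phi> z "-1" x] by simp

lemma supports_diff: "supports \<phi> z \<Longrightarrow> \<phi> (x - y) = \<phi> x - \<phi> y"
  using supports_add[of \<phi> z x "- y"] supports_minus[of \<phi> z y] by simp

lemma supports_Re_le: "supports \<phi> z \<Longrightarrow> Re (\<phi> x) \<le> norm x"
  using supports_bound[of \<phi> z x] complex_Re_le_cmod[of "\<phi> x"] by linarith

lemma supports_positive_multiple:
  assumes "supports \<phi> z" "0 < r"
  shows "supports \<phi> (r *\<^sub>R z)"
  using assms supports_scaleR[OF assms(1), of r z] supports_self[OF assms(1)]
  by (simp add: supports_def)

lemma ex_supports: "\<exists>\<phi>. supports \<phi> z"
proof -
  obtain f where f: "linear f" "\<And>x. f x \<le> norm x" "f z = norm z"
    using ex_norming_linear by blast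
  have fR: "f (r *\<^sub>R x) = r * f x" for r x using linear_scale[OF f(1)] by simp
  have fadd: "f (x + y) = f x + f y" for x y by (rule linear_add[OF f(1)])
  \<comment> \<open>The complex functional whose real part is the real functional \<open>f\<close>.\<close>
  define \<phi> where "\<phi> x = Complex (f x) (- f (\<i> *\<^sub>C x))" for x
  have add: "\<phi> (x + y) = \<phi> x + \<phi> y" for x y
    by (simp add: \<phi>_def fadd scale_right_distrib complex_eq_iff)
  have scale: "\<phi> (c *\<^sub>C x) = c * \<phi> x" for c x
  proof -
    have c: "c *\<^sub>C x = Re c *\<^sub>R x + Im c *\<^sub>R (\<i> *\<^sub>C x)"
    proof -
      have "c *\<^sub>C x = (of_real (Re c) + of_real (Im c) * \<i>) *\<^sub>C x"
        by (simp add: complex_eq_iff[of c])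
      then show ?thesis by (simp add: scaleR_eq_scaleC scale_left_distrib)
    qed
    have ic: "\<i> *\<^sub>C (c *\<^sub>C x) = Re c *\<^sub>R (\<i> *\<^sub>C x) + (- Im c) *\<^sub>R x"
    proof -
      have "\<i> *\<^sub>C (c *\<^sub>C x) = (of_real (Re c) * \<i> + of_real (- Im c)) *\<^sub>C x"
        by (simp add: complex_eq_iff)
      then show ?thesis by (simp only: scaleR_eq_scaleC scale_left_distrib scale_scale)
    qed
    have "f (c *\<^sub>C x) = Re c * f x + Im c * f (\<i> *\<^sub>C x)"
      by (simp only: c fadd fR)
    moreover have "f (\<i> *\<^sub>C (c *\<^sub>C x)) = Re c * f (\<i> *\<^sub>C x) + (- Im c) * f x"
      by (simp only: ic fadd fR)
    ultimately show ?thesis by (simp add: \<phi>_def complex_eq_iff)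
  qed
  have bound: "cmod (\<phi> x) \<le> norm x" for x
  proof (cases "\<phi> x = 0")
    case False
    define c where "c = cnj (\<phi> x) / cmod (\<phi> x)"
    have "of_real (cmod (\<phi> x)) = \<phi> (c *\<^sub>C x)"
      using False complex_norm_square[of "\<phi> x"]
      by (simp add: scale c_def power2_eq_square field_simps)
    then have "cmod (\<phi> x) = f (c *\<^sub>C x)"
      by (metis Re_complex_of_real \<phi>_def complex.sel(1))
    also have "\<dots> \<le> norm (c *\<^sub>C x)" by (rule f(2))
    also have "\<dots> = norm x" using False by (simp add: norm_scaleC c_def norm_divide)
    finally show ?thesis .
  qed simp
  have "\<phi> z = of_real (norm z)"
  proof -
    have re: "Re (\<phi> z) = norm z" by (simp add: \<phi>_def f(3))
    have "(norm z)\<^sup>2 + (Im (\<phi> z))\<^sup>2 \<le> (norm z)\<^sup>2"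
      using power_mono[OF bound[of z], of 2] re by (simp add: cmod_power2)
    then show ?thesis using re by (simp add: complex_eq_iff)
  qed
  then show ?thesis using add scale bound unfolding supports_def by blast
qed

text \<open>Going a small step \<open>h\<close> along the field from \<open>z\<close> to \<open>w\<close>, a functional supporting at the end
  point \<open>w\<close> shows that the norm has grown by \<open>O(h\<^sup>2)\<close> only; this bounds every functional supporting
  at \<open>z\<close>.  So it is enough to have one good supporting functional at each point.\<close>

lemma inward_for_all_supports:
  assumes ex: "\<And>w. \<exists>\<psi>. supports \<psi> w \<and> Re (\<psi> (X w)) \<le> 0"
    and lip: "\<And>w. norm (w - z) \<le> 1 \<Longrightarrow> norm (X w - X z) \<le> C * norm (w - z)"
    and \<phi>: "supports \<phi> z"
  shows "Re (\<phi> (X z)) \<le> 0"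
proof (rule ccontr)
  define e where "e = Re (\<phi> (X z))"
  assume "\<not> Re (\<phi> (X z)) \<le> 0"
  then have e: "0 < e" by (simp add: e_def)
  define n where "n = norm (X z)"
  define D where "D = \<bar>C\<bar> * n"
  define h where "h = min (1 / (n + 1)) (e / (2 * (D + 1)))"
  have n: "0 \<le> n" and D: "0 \<le> D" by (auto simp: n_def D_def)
  have h: "0 < h" using e n D by (simp add: h_def)
  have hn: "h * n \<le> 1"
  proof -
    have "h * n \<le> (1 / (n + 1)) * n" using n by (intro mult_right_mono) (simp_all add: h_def)
    also have "\<dots> \<le> 1" using n by (simp add: field_simps)
    finally show ?thesis .
  qed
  have hD: "h * D < e"
  proof -
    have "h * D \<le> (e / (2 * (D + 1))) * D" using D by (intro mult_right_mono) (simp_all add: h_def)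
    also have "\<dots> < e" using D e by (auto simp: field_simps intro: add_nonneg_pos mult_nonneg_nonneg)
    finally show ?thesis .
  qed
  define w where "w = z + h *\<^sub>R X z"
  have wz: "norm (w - z) = h * n" using h by (simp add: w_def n_def)
  obtain \<psi> where \<psi>: "supports \<psi> w" "Re (\<psi> (X w)) \<le> 0" using ex by blast
  have "norm (X z - X w) \<le> \<bar>C\<bar> * (h * n)"
    using lip[of w] wz hn h n norm_minus_commute[of "X w" "X z"]
    by (smt (verit) mult_right_mono mult_nonneg_nonneg)
  then have XX: "norm (X z - X w) \<le> h * D" by (simp add: D_def mult_ac)
  have w_eq: "w = z + h *\<^sub>R X w + h *\<^sub>R (X z - X w)" by (simp add: w_def algebra_simps)
  have "norm w = Re (\<psi> w)" using supports_self[OF \<psi>(1)] by simp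
  also have "\<dots> = Re (\<psi> (z + h *\<^sub>R X w + h *\<^sub>R (X z - X w)))"
    using arg_cong[OF w_eq, of "\<lambda>x. Re (\<psi> x)"] .
  also have "\<dots> = Re (\<psi> z) + h * Re (\<psi> (X w)) + h * Re (\<psi> (X z - X w))"
    by (simp add: supports_add[OF \<psi>(1)] supports_scaleR[OF \<psi>(1)])
  also have "\<dots> \<le> norm z + 0 + h * (h * D)"
  proof (intro add_mono)
    show "h * Re (\<psi> (X w)) \<le> 0" using h \<psi>(2) by (simp add: mult_le_0_iff)
    show "h * Re (\<psi> (X z - X w)) \<le> h * (h * D)"
      using h supports_Re_le[OF \<psi>(1), of "X z - X w"] XX by (intro mult_left_mono) auto
  qed (rule supports_Re_le[OF \<psi>(1)])
  finally have "norm w \<le> norm z + h * (h * D)" by simp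
  moreover have "norm z + h * e \<le> norm w"
    using supports_Re_le[OF \<phi>, of w] supports_self[OF \<phi>]
    by (simp add: w_def supports_add[OF \<phi>] supports_scaleR[OF \<phi>] e_def)
  ultimately have "h * e \<le> h * (h * D)" by simp
  then show False using h hD by simp
qed

end

section \<open>The exponential series of a bounded operator\<close>

lemma funpow_additive:
  fixes B :: "'a::ab_group_add \<Rightarrow> 'a"
  assumes "\<And>x y. B (x + y) = B x + B y"
  shows "(B ^^ n) (x + y) = (B ^^ n) x + (B ^^ n) y"
  by (induction n) (auto simp: assms)

lemma norm_funpow_le:
  fixes B :: "'a::real_normed_vector \<Rightarrow> 'a"
  assumes "\<And>x. norm (B x) \<le> K * norm x" and "0 \<le> K"
  shows "norm ((B ^^ n) x) \<le> K ^ n * norm x"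
proof (induction n)
  case (Suc n)
  have "norm ((B ^^ Suc n) x) \<le> K * norm ((B ^^ n) x)" using assms(1) by simp
  also have "\<dots> \<le> K * (K ^ n * norm x)" using Suc assms(2) by (rule mult_left_mono)
  finally show ?case by simp
qed simp

lemma summable_exp_operator:
  fixes B :: "'a::banach \<Rightarrow> 'a"
  assumes B: "\<And>x. norm (B x) \<le> K * norm x" and K: "0 \<le> K"
  shows "summable (\<lambda>n. norm ((B ^^ n) x /\<^sub>R fact n))" (is ?norms)
    and "summable (\<lambda>n. (B ^^ n) x /\<^sub>R fact n)"
proof -
  have "summable (\<lambda>n. (K ^ n /\<^sub>R fact n) * norm x)"
    by (intro summable_mult2 summable_exp_generic)
  then show ?norms
  proof (rule summable_comparison_test'[where N = 0])
    fix n :: nat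
    show "norm (norm ((B ^^ n) x /\<^sub>R fact n)) \<le> (K ^ n /\<^sub>R fact n) * norm x"
      using norm_funpow_le[OF B K, of n x] by (simp add: field_simps)
  qed
  then show "summable (\<lambda>n. (B ^^ n) x /\<^sub>R fact n)" by (rule summable_norm_cancel)
qed

lemma norm_exp_operator_le:
  fixes B :: "'a::banach \<Rightarrow> 'a"
  assumes B: "\<And>x. norm (B x) \<le> K * norm x" and K: "0 \<le> K"
  shows "norm (exp_operator B x) \<le> exp K * norm x"
proof -
  have sK: "summable (\<lambda>n. (K ^ n /\<^sub>R fact n) * norm x)"
    by (intro summable_mult2 summable_exp_generic)
  have "norm (exp_operator B x) \<le> (\<Sum>n. norm ((B ^^ n) x /\<^sub>R fact n))"
    unfolding exp_operator_def by (rule summable_norm[OF summable_exp_operator(1)[OF B K]])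
  also have "\<dots> \<le> (\<Sum>n. (K ^ n /\<^sub>R fact n) * norm x)"
  proof (rule suminf_le[OF _ summable_exp_operator(1)[OF B K] sK])
    fix n show "norm ((B ^^ n) x /\<^sub>R fact n) \<le> (K ^ n /\<^sub>R fact n) * norm x"
      using norm_funpow_le[OF B K, of n x] by (simp add: field_simps)
  qed
  also have "\<dots> = exp K * norm x"
    unfolding exp_def by (rule suminf_mult2[symmetric, OF summable_exp_generic])
  finally show ?thesis .
qed

lemma exp_operator_first_order:
  fixes B :: "'a::banach \<Rightarrow> 'a"
  assumes B: "\<And>x. norm (B x) \<le> K * norm x" and K: "0 \<le> K"
  shows "norm (exp_operator B x - x - B x) \<le> K\<^sup>2 * exp K * norm x"
proof -
  define f where "f = (\<lambda>n. (B ^^ n) x /\<^sub>R fact n)"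
  define g where "g n = K\<^sup>2 * (K ^ n /\<^sub>R fact n) * norm x" for n
  have f: "summable f" using summable_exp_operator(2)[OF B K] by (simp add: f_def)
  have sg: "summable g" unfolding g_def
    by (intro summable_mult2 summable_mult summable_exp_generic)
  have "exp_operator B x = (\<Sum>n. f (n + 2)) + (f 0 + f 1)"
    unfolding exp_operator_def using suminf_split_initial_segment[OF f, of 2]
    by (simp add: f_def[symmetric] numeral_2_eq_2 add.commute)
  then have "exp_operator B x - x - B x = (\<Sum>n. f (n + 2))" by (simp add: f_def)
  moreover have fg: "norm (f (n + 2)) \<le> g n" for n
  proof -
    have fct: "fact n \<le> (fact (n + 2) :: real)"
      by (rule fact_mono) simp
    have "norm (f (n + 2)) \<le> K ^ (n + 2) * norm x / fact (n + 2)"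
      unfolding f_def using norm_funpow_le[OF B K, of "n + 2" x]
      by (simp only: norm_scaleR) (simp add: divide_simps del: fact_Suc funpow.simps)
    also have "\<dots> \<le> K ^ (n + 2) * norm x / fact n"
      using K fct by (intro divide_left_mono) (auto intro!: mult_nonneg_nonneg)
    finally show ?thesis by (simp add: g_def power_add power2_eq_square field_simps)
  qed
  moreover have "norm (\<Sum>n. f (n + 2)) \<le> (\<Sum>n. g n)"
  proof -
    have s: "summable (\<lambda>n. norm (f (n + 2)))"
      by (rule summable_comparison_test'[OF sg, where N = 0]) (use fg in simp)
    show ?thesis
      using summable_norm[OF s] suminf_le[OF fg s sg] by linarith
  qed
  moreover have "(\<Sum>n. g n) = K\<^sup>2 * exp K * norm x"
  proof -
    have "(\<Sum>n. g n) = (\<Sum>n. K\<^sup>2 * (K ^ n /\<^sub>R fact n)) * norm x"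
      unfolding g_def by (rule suminf_mult2[symmetric]) (intro summable_mult summable_exp_generic)
    also have "(\<Sum>n. K\<^sup>2 * (K ^ n /\<^sub>R fact n)) = K\<^sup>2 * exp K"
      unfolding exp_def by (rule suminf_mult[OF summable_exp_generic])
    finally show ?thesis .
  qed
  ultimately show ?thesis by simp
qed

section \<open>Hermitian operators with non-negative spectrum\<close>

context complex_banach
begin

lemma bounded_clinearD:
  assumes "bounded_clinear scaleC A"
  shows "A (x + y) = A x + A y" "A (c *\<^sub>C x) = c *\<^sub>C A x" "A (x - y) = A x - A y"
    "A (r *\<^sub>R x) = r *\<^sub>R A x" "A 0 = 0" "A (- x) = - A x"
    "\<exists>K>0. \<forall>x. norm (A x) \<le> K * norm x"
proof -
  have l: "Vector_Spaces.linear scaleC scaleC A" and b: "bounded_linear A"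
    using assms by (auto simp: bounded_clinear_def)
  interpret bl: bounded_linear A by (rule b)
  show "A (x + y) = A x + A y" "A (x - y) = A x - A y"
    "A (r *\<^sub>R x) = r *\<^sub>R A x" "A 0 = 0"
    by (auto simp: bl.add bl.diff bl.scaleR bl.zero)
  show "A (- x) = - A x" using bl.diff[of 0 x] by (simp add: bl.zero)
  show "A (c *\<^sub>C x) = c *\<^sub>C A x"
    using l by (simp add: Vector_Spaces.linear_iff)
  show "\<exists>K>0. \<forall>x. norm (A x) \<le> K * norm x"
    using bl.pos_bounded by (auto simp: mult.commute)
qed

lemma bounded_clinearI:
  assumes "\<And>x y. A (x + y) = A x + A y" "\<And>c x. A (c *\<^sub>C x) = c *\<^sub>C A x"
    "\<And>x. norm (A x) \<le> K * norm x"
  shows "bounded_clinear scaleC A"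
proof -
  have "Vector_Spaces.linear scaleC scaleC A"
    by unfold_locales (use assms in auto)
  moreover have "bounded_linear A"
    by (rule bounded_linear_intro[where K = K])
      (use assms in \<open>auto simp: scaleR_eq_scaleC mult.commute\<close>)
  ultimately show ?thesis by (simp add: bounded_clinear_def)
qed

text \<open>To first order \<open>exp (i t A) x\<close> is \<open>x + i t A x\<close>, so a functional supporting at \<open>x\<close> sees the norm change
  by \<open>- t Im (\<phi> (A x))\<close>; for an isometry this must vanish.\<close>

lemma hermitian_operator_real:
  assumes A: "hermitian_operator scaleC A" and \<phi>: "supports \<phi> x"
  shows "Im (\<phi> (A x)) = 0"
proof -
  have bA: "bounded_clinear scaleC A" using A by (simp add: hermitian_operator_def)
  obtain K where K: "K > 0" "\<And>x. norm (A x) \<le> K * norm x"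
    using bounded_clinearD(7)[OF bA] by blast
  define C where "C = K\<^sup>2 * exp K * norm x"
  have est: "- (t * Im (\<phi> (A x))) \<le> t\<^sup>2 * C" if t: "\<bar>t\<bar> \<le> 1" for t
  proof -
    define B where "B = (\<lambda>y. (\<i> * of_real t) *\<^sub>C A y)"
    have B: "norm (B y) \<le> (\<bar>t\<bar> * K) * norm y" for y
      using K(2)[of y] mult_left_mono[of "norm (A y)" "K * norm y" "\<bar>t\<bar>"]
      by (simp add: B_def norm_scaleC norm_mult mult.assoc)
    have iso: "norm (exp_operator B x) = norm x"
      using A by (auto simp: hermitian_operator_def B_def)
    have "norm x - t * Im (\<phi> (A x)) = Re (\<phi> (x + B x))"
      by (simp add: B_def supports_add[OF \<phi>] supports_scaleC[OF \<phi>] supports_self[OF \<phi>])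
    also have "\<dots> \<le> norm (x + B x)" by (rule supports_Re_le[OF \<phi>])
    also have "\<dots> = norm (exp_operator B x - (exp_operator B x - x - B x))"
      by (simp add: add.commute)
    also have "\<dots> \<le> norm (exp_operator B x) + norm (exp_operator B x - x - B x)"
      by (rule norm_triangle_ineq4)
    also have "\<dots> \<le> norm x + (\<bar>t\<bar> * K)\<^sup>2 * exp (\<bar>t\<bar> * K) * norm x"
      using exp_operator_first_order[OF B, of x] K(1) iso by simp
    also have "\<dots> \<le> norm x + (\<bar>t\<bar> * K)\<^sup>2 * exp K * norm x"
    proof -
      have "\<bar>t\<bar> * K \<le> K" using t K(1) by simp
      then show ?thesis by (intro add_mono mult_mono) auto
    qed
    finally show ?thesis by (simp add: C_def power_mult_distrib mult_ac)
  qed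
  have C: "0 \<le> C" by (simp add: C_def)
  have le: "r \<le> 0" if r: "\<And>t. 0 < t \<Longrightarrow> t \<le> 1 \<Longrightarrow> t * r \<le> t\<^sup>2 * C" for r
  proof (rule field_le_epsilon)
    fix e :: real assume e: "0 < e"
    define t where "t = min 1 (e / (\<bar>C\<bar> + 1))"
    have t: "0 < t" "t \<le> 1" using e by (auto simp: t_def)
    have "r \<le> t * C" using r[OF t] t(1) by (simp add: power2_eq_square)
    also have "\<dots> \<le> (e / (\<bar>C\<bar> + 1)) * (\<bar>C\<bar> + 1)"
      using t e C by (intro mult_mono) (auto simp: t_def)
    also have "\<dots> = e" by simp
    finally show "r \<le> 0 + e" by simp
  qed
  have "- Im (\<phi> (A x)) \<le> 0"
  proof (rule le)
    fix t :: real assume t: "0 < t" "t \<le> 1"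
    show "t * (- Im (\<phi> (A x))) \<le> t\<^sup>2 * C" using est[of t] t by simp
  qed
  moreover have "Im (\<phi> (A x)) \<le> 0"
  proof (rule le)
    fix t :: real assume t: "0 < t" "t \<le> 1"
    show "t * Im (\<phi> (A x)) \<le> t\<^sup>2 * C" using est[of "- t"] t by simp
  qed
  ultimately show ?thesis by simp
qed

text \<open>On the circle with diameter \<open>[p, q]\<close> one has \<open>\<bar>z - p\<bar> \<bar>z - q\<bar> = (q - p) \<bar>Im z\<bar>\<close>, which cancels
  the singularity of the bound \<open>1 / \<bar>Im z\<bar>\<close> for the resolvent of an operator with real numerical
  range.  The maximum principle for \<open>(z - p) (z - q) \<phi> (R z y)\<close> with \<open>p \<rightarrow> -\<infinity>\<close> and \<open>q \<rightarrow> 0\<close> then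
  gives the sharp resolvent bound on the negative half line.\<close>

lemma resolvent_bound_of_nonneg_spectrum:
  assumes A: "bounded_clinear scaleC A"
    and real: "\<And>\<phi> x. supports \<phi> x \<Longrightarrow> Im (\<phi> (A x)) = 0"
    and spec: "operator_spectrum scaleC A \<subseteq> \<real>\<^sub>\<ge>\<^sub>0"
    and l: "0 < l"
  shows "l * norm x \<le> norm (A x + l *\<^sub>R x)"
proof -
  note Aadd = bounded_clinearD(1)[OF A] and AC = bounded_clinearD(2)[OF A]
    and Adiff = bounded_clinearD(3)[OF A]
  have "\<forall>z. \<exists>B. z \<notin> \<real>\<^sub>\<ge>\<^sub>0 \<longrightarrow> bounded_clinear scaleC B \<and>
      (\<forall>x. B (A x - z *\<^sub>C x) = x) \<and> (\<forall>x. A (B x) - z *\<^sub>C B x = x)"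
    using spec by (fastforce simp: operator_spectrum_def)
  then obtain R where R: "\<And>z. z \<notin> \<real>\<^sub>\<ge>\<^sub>0 \<Longrightarrow> bounded_clinear scaleC (R z)"
    "\<And>z x. z \<notin> \<real>\<^sub>\<ge>\<^sub>0 \<Longrightarrow> R z (A x - z *\<^sub>C x) = x"
    "\<And>z x. z \<notin> \<real>\<^sub>\<ge>\<^sub>0 \<Longrightarrow> A (R z x) - z *\<^sub>C R z x = x"
    by metis
  have imag: "\<bar>Im z\<bar> * norm (R z y) \<le> norm y" if z: "z \<notin> \<real>\<^sub>\<ge>\<^sub>0" for z y
  proof -
    obtain \<phi> where \<phi>: "supports \<phi> (R z y)" using ex_supports by blast
    have "Im (\<phi> y) = - (Im z * norm (R z y))"
      by (subst R(3)[OF z, of y, symmetric])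
        (simp add: supports_diff[OF \<phi>] supports_scaleC[OF \<phi>] supports_self[OF \<phi>] real[OF \<phi>])
    then have "\<bar>Im z\<bar> * norm (R z y) = \<bar>Im (\<phi> y)\<bar>" by (simp add: abs_mult)
    also have "\<dots> \<le> norm y"
      using abs_Im_le_cmod[of "\<phi> y"] supports_bound[OF \<phi>, of y] by linarith
    finally show ?thesis .
  qed
  have identity: "R w y - R z y = (w - z) *\<^sub>C R w (R z y)"
    if w: "w \<notin> \<real>\<^sub>\<ge>\<^sub>0" and z: "z \<notin> \<real>\<^sub>\<ge>\<^sub>0" for w z y
  proof -
    have "y = (A (R z y) - w *\<^sub>C R z y) + (w - z) *\<^sub>C R z y"
      using R(3)[OF z, of y] by (simp add: scale_left_diff_distrib)
    then have "R w y = R w (A (R z y) - w *\<^sub>C R z y) + (w - z) *\<^sub>C R w (R z y)"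
      using bounded_clinearD(1,2)[OF R(1)[OF w]] by metis
    then show ?thesis by (simp add: R(2)[OF w])
  qed
  have deriv: "((\<lambda>w. \<phi> (R w y)) has_field_derivative \<phi> (R z (R z y))) (at z)"
    if \<phi>: "supports \<phi> u" and z: "z \<notin> \<real>\<^sub>\<ge>\<^sub>0" for \<phi> u z y
  proof -
    obtain K where K: "K > 0" "\<And>x. norm (R z x) \<le> K * norm x"
      using bounded_clinearD(7)[OF R(1)[OF z]] by blast
    define v where "v = R z y"
    have "open (- \<real>\<^sub>\<ge>\<^sub>0 :: complex set)" using closed_nonneg_Reals_complex by (simp add: open_Compl)
    then have ev1: "\<forall>\<^sub>F w in at z. w \<in> - \<real>\<^sub>\<ge>\<^sub>0"
      by (rule eventually_at_in_open') (use z in simp)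
    have "((\<lambda>w. norm (w - z)) \<longlongrightarrow> norm (z - z)) (at z)" by (intro tendsto_intros)
    then have tn: "((\<lambda>w. norm (w - z)) \<longlongrightarrow> 0) (at z)" by simp
    have ev2: "\<forall>\<^sub>F w in at z. norm (w - z) < 1 / (2 * K)"
      by (rule order_tendstoD(2)[OF tn]) (use K in simp)
    have "((\<lambda>w. \<phi> (R w v) - \<phi> (R z v)) \<longlongrightarrow> 0) (at z)"
    proof (rule Lim_null_comparison)
      show "((\<lambda>w. norm (w - z) * (2 * K * norm (R z v))) \<longlongrightarrow> 0) (at z)"
        using tendsto_mult[OF tn tendsto_const, of "2 * K * norm (R z v)"] by simp
      show "\<forall>\<^sub>F w in at z. norm (\<phi> (R w v) - \<phi> (R z v)) \<le> norm (w - z) * (2 * K * norm (R z v))"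
        using ev1 ev2
      proof eventually_elim
        case (elim w)
        then have w: "w \<notin> \<real>\<^sub>\<ge>\<^sub>0" and wz: "norm (w - z) * K \<le> 1 / 2"
          using K(1) by (auto simp: field_simps)
        have bd: "norm (R w y) \<le> 2 * K * norm y" for y
        proof -
          have "norm (R w y) = norm (R z y - (z - w) *\<^sub>C R z (R w y))"
            using identity[OF z w, of y] by (simp add: algebra_simps)
          also have "\<dots> \<le> norm (R z y) + norm (w - z) * norm (R z (R w y))"
            using norm_triangle_ineq4[of "R z y" "(z - w) *\<^sub>C R z (R w y)"]
            by (simp add: norm_scaleC norm_minus_commute)
          also have "\<dots> \<le> K * norm y + norm (w - z) * (K * norm (R w y))"
            using K(2) by (intro add_mono mult_left_mono) auto
          also have "norm (w - z) * (K * norm (R w y)) \<le> (1 / 2) * norm (R w y)"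
            unfolding mult.assoc[symmetric] using wz by (intro mult_right_mono) auto
          finally show ?thesis by simp
        qed
        have "norm (\<phi> (R w v) - \<phi> (R z v)) = norm (\<phi> (R w v - R z v))"
          by (simp add: supports_diff[OF \<phi>])
        also have "\<dots> \<le> norm (R w v - R z v)" by (rule supports_bound[OF \<phi>])
        also have "\<dots> = norm (w - z) * norm (R w (R z v))"
          by (simp add: identity[OF w z] norm_scaleC)
        also have "\<dots> \<le> norm (w - z) * (2 * K * norm (R z v))"
          using bd by (intro mult_left_mono) auto
        finally show ?case .
      qed
    qed
    then have "((\<lambda>w. \<phi> (R w v)) \<longlongrightarrow> \<phi> (R z v)) (at z)"
      by (simp add: LIM_zero_iff)
    moreover have "\<forall>\<^sub>F w in at z. \<phi> (R w v) = (\<phi> (R w y) - \<phi> (R z y)) / (w - z)"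
      using ev1 eventually_neq_at_within[of z]
    proof eventually_elim
      case (elim w)
      then have "\<phi> (R w y) - \<phi> (R z y) = (w - z) * \<phi> (R w v)"
        using identity[OF _ z, of w y]
        by (simp add: supports_diff[OF \<phi>, symmetric] supports_scaleC[OF \<phi>] v_def)
      then show ?case using elim by simp
    qed
    ultimately have "((\<lambda>w. (\<phi> (R w y) - \<phi> (R z y)) / (w - z)) \<longlongrightarrow> \<phi> (R z v)) (at z)"
      by (rule Lim_transform_eventually)
    then show ?thesis by (simp add: has_field_derivative_iff v_def)
  qed
  define y where "y = A x + l *\<^sub>R x"
  have l': "- of_real l \<notin> (\<real>\<^sub>\<ge>\<^sub>0 :: complex set)"
    using l by (simp add: complex_nonneg_Reals_iff)
  have Rl: "R (- of_real l) y = x"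
    using R(2)[OF l', of x] by (simp add: y_def scaleR_eq_scaleC)
  obtain \<phi> where \<phi>: "supports \<phi> x" using ex_supports by blast
  have bound: "(N - l) * (l - e) * norm x \<le> (N - e) * norm y"
    if e: "0 < e" "e < l" and N: "l < N" for e N
  proof -
    define c r where "c = - (N + e) / 2" and "r = (N - e) / 2"
    define g where "g z = (z + of_real N) * (z + of_real e) * \<phi> (R z y)" for z
    have r: "0 < r" using e N by (simp add: r_def)
    have sub: "z \<notin> \<real>\<^sub>\<ge>\<^sub>0" if z: "z \<in> cball (complex_of_real c) r" for z
    proof -
      have "\<bar>Re z - c\<bar> \<le> r"
        using z abs_Re_le_cmod[of "z - of_real c"] by (simp add: dist_norm norm_minus_commute)
      then have "Re z \<le> - e" by (simp add: c_def r_def field_simps abs_le_iff)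
      then show ?thesis using e by (auto simp: complex_nonneg_Reals_iff)
    qed
    have hol: "g holomorphic_on cball (of_real c) r"
    proof -
      have "(\<lambda>z. \<phi> (R z y)) holomorphic_on cball (of_real c) r"
      proof (rule holomorphic_onI)
        fix z :: complex assume "z \<in> cball (of_real c) r"
        then show "(\<lambda>z. \<phi> (R z y)) field_differentiable at z within cball (of_real c) r"
          using deriv[OF \<phi> sub] field_differentiable_at_within field_differentiable_def by blast
      qed
      then show ?thesis unfolding g_def by (intro holomorphic_intros)
    qed
    have "norm (g (- of_real l)) \<le> (N - e) * norm y"
    proof (rule maximum_modulus_frontier[where f = g and S = "cball (of_real c) r"
          and \<xi> = "- of_real l"])
      show "g holomorphic_on interior (cball (complex_of_real c) r)"
        using hol by (rule holomorphic_on_subset) (simp add: ball_subset_cball)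
      show "continuous_on (closure (cball (complex_of_real c) r)) g"
        using holomorphic_on_imp_continuous_on[OF hol] by simp
      have "- complex_of_real l - of_real c = of_real (- (l + c))" by simp
      then have "norm (- complex_of_real l - of_real c) = \<bar>l + c\<bar>"
        by (simp only: norm_of_real abs_minus_cancel)
      then show "- complex_of_real l \<in> cball (of_real c) r"
        using e N by (simp add: dist_norm norm_minus_commute c_def r_def field_simps abs_le_iff)
      fix z assume "z \<in> frontier (cball (complex_of_real c) r)"
      then have zr: "norm (z - of_real c) = r"
        using r by (simp add: frontier_cball dist_norm norm_minus_commute)
      then have z: "z \<notin> \<real>\<^sub>\<ge>\<^sub>0" by (intro sub) (simp add: dist_norm norm_minus_commute)
      define u where "u = Re z - c"
      have "u\<^sup>2 + (Im z)\<^sup>2 = r\<^sup>2"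
        using arg_cong[OF zr, of "\<lambda>t. t\<^sup>2"] by (simp add: cmod_power2 u_def)
      then have circ: "(Im z)\<^sup>2 = r\<^sup>2 - u\<^sup>2" by simp
      have ends: "Re z + N = u + r" "Re z + e = u - r" "N - e = 2 * r"
        by (simp_all add: u_def c_def r_def field_simps)
      have "(norm (z + of_real N) * norm (z + of_real e))\<^sup>2
          = ((u + r)\<^sup>2 + (Im z)\<^sup>2) * ((u - r)\<^sup>2 + (Im z)\<^sup>2)"
        by (simp add: power_mult_distrib cmod_power2 ends)
      also have "\<dots> = (2 * r)\<^sup>2 * (Im z)\<^sup>2"
        unfolding circ by (simp add: power2_eq_square algebra_simps)
      also have "\<dots> = ((N - e) * \<bar>Im z\<bar>)\<^sup>2"
        by (simp only: ends power_mult_distrib power2_abs)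
      finally have prod: "norm (z + of_real N) * norm (z + of_real e) = (N - e) * \<bar>Im z\<bar>"
        by (rule power2_eq_imp_eq) (use e N in auto)
      have "norm (g z) = ((N - e) * \<bar>Im z\<bar>) * norm (\<phi> (R z y))"
        by (simp add: g_def norm_mult prod)
      also have "\<dots> \<le> ((N - e) * \<bar>Im z\<bar>) * norm (R z y)"
        using e N by (intro mult_left_mono supports_bound[OF \<phi>]) auto
      also have "\<dots> = (N - e) * (\<bar>Im z\<bar> * norm (R z y))" by simp
      also have "\<dots> \<le> (N - e) * norm y"
        using e N imag[OF z, of y] by (intro mult_left_mono) auto
      finally show "norm (g z) \<le> (N - e) * norm y" .
    qed simp
    moreover have "norm (g (- of_real l)) = (N - l) * (l - e) * norm x"
    proof -
      have "g (- of_real l) = of_real ((N - l) * (e - l) * norm x)"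
        by (simp add: g_def Rl supports_self[OF \<phi>])
      then have "norm (g (- of_real l)) = \<bar>(N - l) * (e - l) * norm x\<bar>"
        by (simp only: norm_of_real)
      then show ?thesis using e N by (simp add: abs_mult)
    qed
    ultimately show ?thesis by simp
  qed
  have lim1: "(\<lambda>n. (1 - l / real n) * (l - 1 / real n) * norm x) \<longlonglongrightarrow> (1 - 0) * (l - 0) * norm x"
    by (intro tendsto_intros lim_const_over_n)
  have lim2: "(\<lambda>n. (1 - (1 / real n) * (1 / real n)) * norm y) \<longlonglongrightarrow> (1 - 0 * 0) * norm y"
    by (intro tendsto_intros lim_const_over_n)
  have ev: "\<forall>\<^sub>F n in sequentially.
      (1 - l / real n) * (l - 1 / real n) * norm x \<le> (1 - (1 / real n) * (1 / real n)) * norm y"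
    using eventually_gt_at_top[of "nat \<lceil>max l (1 / l)\<rceil>"]
  proof eventually_elim
    case (elim n)
    then have n: "max l (1 / l) < real n" by linarith
    then have n0: "0 < real n" using l by linarith
    have n1: "l < real n" using n by simp
    have "1 / l < real n" using n by simp
    then have n2: "1 / real n < l"
      using n0 l by (simp only: pos_divide_less_eq mult.commute)
    have "(real n - l) * (l - 1 / real n) * norm x \<le> (real n - 1 / real n) * norm y"
      by (rule bound) (use n0 n1 n2 in auto)
    then have "((real n - l) * (l - 1 / real n) * norm x) / real n
        \<le> ((real n - 1 / real n) * norm y) / real n"
      using n0 by (intro divide_right_mono) auto
    moreover have "1 - l / real n = (real n - l) / real n"
      and "1 - (1 / real n) * (1 / real n) = (real n - 1 / real n) / real n"
      using n0 by (simp_all add: diff_divide_distrib)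
    ultimately show ?case by simp
  qed
  have "(1 - 0) * (l - 0) * norm x \<le> (1 - 0 * 0) * norm y"
    by (rule tendsto_le[OF sequentially_bot lim2 lim1 ev])
  then show ?thesis by (simp add: y_def)
qed

text \<open>The resolvent bound for all \<open>l = 1 / s\<close> gives \<open>\<parallel>x - s A x\<parallel> \<le> \<parallel>x\<parallel> + O(s\<^sup>2)\<close>, and this inequality
  controls every functional supporting at \<open>x\<close>.\<close>

lemma nonneg_numerical_range:
  assumes A: "bounded_clinear scaleC A"
    and real: "\<And>\<phi> x. supports \<phi> x \<Longrightarrow> Im (\<phi> (A x)) = 0"
    and spec: "operator_spectrum scaleC A \<subseteq> \<real>\<^sub>\<ge>\<^sub>0"
    and \<phi>: "supports \<phi> x"
  shows "0 \<le> Re (\<phi> (A x))"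
proof (rule field_le_epsilon)
  fix e :: real assume e: "0 < e"
  define s where "s = e / (norm (A (A x)) + 1)"
  have s: "0 < s" using e by (simp add: s_def add_nonneg_pos)
  define w where "w = x - s *\<^sub>R A x"
  note D = bounded_clinearD[OF A]
  have res: "l * norm y \<le> norm (A y + l *\<^sub>R y)" if "0 < l" for l y
    by (rule resolvent_bound_of_nonneg_spectrum[OF A _ spec that]) (rule real)
  have "norm w = s * ((1 / s) * norm w)" using s by simp
  also have "\<dots> \<le> s * norm (A w + (1 / s) *\<^sub>R w)"
    using res[of "1 / s" w] s by (simp add: pos_divide_le_eq mult.commute)
  also have "\<dots> = norm (s *\<^sub>R (A w + (1 / s) *\<^sub>R w))" using s by simp
  also have "s *\<^sub>R (A w + (1 / s) *\<^sub>R w) = x - (s * s) *\<^sub>R A (A x)"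
    using s by (simp add: w_def D(3,4) scaleR_right_distrib scaleR_right_diff_distrib)
  also have "norm \<dots> \<le> norm x + norm ((s * s) *\<^sub>R A (A x))" by (rule norm_triangle_ineq4)
  also have "\<dots> = norm x + s * (s * norm (A (A x)))" using s by simp
  finally have "norm w \<le> norm x + s * (s * norm (A (A x)))" .
  moreover have "norm x - s * Re (\<phi> (A x)) \<le> norm w"
    using supports_Re_le[OF \<phi>, of w]
    by (simp add: w_def supports_diff[OF \<phi>] supports_scaleR[OF \<phi>] supports_self[OF \<phi>])
  ultimately have "s * (- Re (\<phi> (A x))) \<le> s * (s * norm (A (A x)))" by simp
  then have "- Re (\<phi> (A x)) \<le> s * norm (A (A x))" using s by (simp only: mult_le_cancel_left_pos)
  also have "\<dots> \<le> s * (norm (A (A x)) + 1)" using s by simp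
  also have "\<dots> = e" using add_nonneg_pos[OF norm_ge_zero zero_less_one, of "A (A x)"]
    by (simp add: s_def)
  finally show "0 \<le> Re (\<phi> (A x)) + e" by simp
qed

end

section \<open>Flows of dissipative operators\<close>

definition flow :: "('a::banach \<Rightarrow> 'a) \<Rightarrow> real \<Rightarrow> 'a \<Rightarrow> 'a" where
  "flow T t = exp_operator (\<lambda>y. t *\<^sub>R T y)"

lemma funpow_scaleR:
  fixes T :: "'a::real_normed_vector \<Rightarrow> 'a"
  assumes "bounded_linear T"
  shows "((\<lambda>y. t *\<^sub>R T y) ^^ n) x = t ^ n *\<^sub>R (T ^^ n) x"
  by (induction n) (simp_all add: linear_simps(5)[OF assms])

lemma bounded_linear_funpow:
  fixes T :: "'a::real_normed_vector \<Rightarrow> 'a"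
  assumes "bounded_linear T"
  shows "bounded_linear (T ^^ n)"
proof (induction n)
  case 0
  show ?case by (simp add: id_def bounded_linear_ident)
next
  case (Suc n)
  have "bounded_linear (\<lambda>x. T ((T ^^ n) x))" by (rule bounded_linear_compose[OF assms Suc])
  then show ?case by (simp add: o_def)
qed

lemma ex_norm_bound:
  assumes "bounded_linear T"
  obtains K where "0 < K" "\<And>x. norm (T x) \<le> K * norm x"
  using bounded_linear.pos_bounded[OF assms] by (auto simp: mult.commute)

lemma norm_scaled_le:
  fixes T :: "'a::real_normed_vector \<Rightarrow> 'a"
  assumes "\<And>x. norm (T x) \<le> K * norm x"
  shows "norm (t *\<^sub>R T x) \<le> (\<bar>t\<bar> * K) * norm x"
  using mult_left_mono[OF assms[of x], of "\<bar>t\<bar>"] by (simp add: mult_ac)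

lemma flow_sums:
  fixes T :: "'a::banach \<Rightarrow> 'a"
  assumes T: "bounded_linear T"
  shows "(\<lambda>n. (t ^ n /\<^sub>R fact n) *\<^sub>R (T ^^ n) x) sums flow T t x"
proof -
  obtain K where K: "0 < K" "\<And>x. norm (T x) \<le> K * norm x" using ex_norm_bound[OF T] by blast
  have "summable (\<lambda>n. ((\<lambda>y. t *\<^sub>R T y) ^^ n) x /\<^sub>R fact n)"
    by (rule summable_exp_operator(2)[OF norm_scaled_le[OF K(2)]]) (use K in simp)
  then have "(\<lambda>n. ((\<lambda>y. t *\<^sub>R T y) ^^ n) x /\<^sub>R fact n) sums flow T t x"
    unfolding flow_def exp_operator_def by (rule summable_sums)
  then show ?thesis by (simp add: funpow_scaleR[OF T] mult.commute)
qed

lemma norm_flow_le: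
  fixes T :: "'a::banach \<Rightarrow> 'a"
  assumes K: "0 \<le> K" "\<And>x. norm (T x) \<le> K * norm x"
  shows "norm (flow T t x) \<le> exp (\<bar>t\<bar> * K) * norm x"
  unfolding flow_def by (rule norm_exp_operator_le[OF norm_scaled_le[OF K(2)]]) (use K in simp)

lemma flow_first_order:
  fixes T :: "'a::banach \<Rightarrow> 'a"
  assumes K: "0 \<le> K" "\<And>x. norm (T x) \<le> K * norm x"
  shows "norm (flow T t x - x - t *\<^sub>R T x) \<le> (\<bar>t\<bar> * K)\<^sup>2 * exp (\<bar>t\<bar> * K) * norm x"
  unfolding flow_def by (rule exp_operator_first_order[OF norm_scaled_le[OF K(2)]]) (use K in simp)

text \<open>The product of the partial sums and the partial sum of the product differ by the terms
  \<open>(m, n)\<close> with \<open>m, n < N \<le> m + n\<close>, whose norms are dominated by the corresponding scalar terms.\<close>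

lemma flow_add:
  fixes T :: "'a::banach \<Rightarrow> 'a"
  assumes T: "bounded_linear T"
  shows "flow T (s + t) x = flow T s (flow T t x)"
proof -
  obtain K where K: "0 < K" "\<And>x. norm (T x) \<le> K * norm x" using ex_norm_bound[OF T] by blast
  note K' = less_imp_le[OF K(1)] K(2)
  define e where "e r n = r ^ n /\<^sub>R fact n" for r :: real and n :: nat
  define P where "P r N x = (\<Sum>n<N. e r n *\<^sub>R (T ^^ n) x)" for r N x
  have Plim: "(\<lambda>N. P r N x) \<longlonglongrightarrow> flow T r x" for r x
    using flow_sums[OF T, of r x] by (simp add: sums_def P_def e_def)
  have elim: "(\<lambda>N. \<Sum>n<N. e r n) \<longlonglongrightarrow> exp r" for r
    using exp_converges[of r] by (simp add: sums_def e_def)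
  have esum: "(\<Sum>i\<le>k. e a i * e b (k - i)) = e (a + b) k" for a b k
    unfolding e_def by (rule exp_series_add_commuting[symmetric]) simp
  have blP: "bounded_linear (P r N)" for r N
    unfolding P_def
    by (intro bounded_linear_sum bounded_linear_scaleR_right
        bounded_linear_compose[OF bounded_linear_scaleR_right] bounded_linear_funpow T)
  have normP: "norm (P r N x) \<le> exp (\<bar>r\<bar> * K) * norm x" for r N x
  proof -
    have "norm (P r N x) \<le> (\<Sum>n<N. norm (e r n *\<^sub>R (T ^^ n) x))"
      unfolding P_def by (rule norm_sum)
    also have "\<dots> \<le> (\<Sum>n<N. e (\<bar>r\<bar> * K) n * norm x)"
    proof (rule sum_mono)
      fix n
      have "norm (e r n *\<^sub>R (T ^^ n) x) \<le> (\<bar>r\<bar> ^ n / fact n) * (K ^ n * norm x)"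
        using mult_left_mono[OF norm_funpow_le[OF K(2) K'(1), of n x], of "\<bar>r\<bar> ^ n / fact n"]
        by (simp add: e_def abs_mult power_abs divide_inverse mult.commute)
      then show "norm (e r n *\<^sub>R (T ^^ n) x) \<le> e (\<bar>r\<bar> * K) n * norm x"
        by (simp add: e_def power_mult_distrib field_simps)
    qed
    also have "\<dots> = (\<Sum>n<N. e (\<bar>r\<bar> * K) n) * norm x" by (rule sum_distrib_right[symmetric])
    also have "\<dots> \<le> exp (\<bar>r\<bar> * K) * norm x"
    proof (rule mult_right_mono)
      have "(\<Sum>n<N. e (\<bar>r\<bar> * K) n) \<le> (\<Sum>n. e (\<bar>r\<bar> * K) n)"
      proof (rule sum_le_suminf)
        show "summable (\<lambda>n. e (\<bar>r\<bar> * K) n)"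
          unfolding e_def by (rule summable_exp_generic)
      qed (use K in \<open>auto simp: e_def\<close>)
      then show "(\<Sum>n<N. e (\<bar>r\<bar> * K) n) \<le> exp (\<bar>r\<bar> * K)" by (simp add: exp_def e_def)
    qed simp
    finally show ?thesis .
  qed
  have "(\<lambda>N. P s N (P t N x)) \<longlonglongrightarrow> flow T s (flow T t x)"
  proof (rule Lim_transform[OF Plim[of s "flow T t x"]])
    show "(\<lambda>N. P s N (P t N x) - P s N (flow T t x)) \<longlonglongrightarrow> 0"
    proof (rule Lim_null_comparison)
      show "\<forall>\<^sub>F N in sequentially. norm (P s N (P t N x) - P s N (flow T t x))
          \<le> exp (\<bar>s\<bar> * K) * norm (P t N x - flow T t x)"
        using normP by (auto simp: linear_simps(2)[OF blP, symmetric])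
      have "(\<lambda>N. P t N x - flow T t x) \<longlonglongrightarrow> 0" using Plim[of t x] by (simp add: LIM_zero)
      then show "(\<lambda>N. exp (\<bar>s\<bar> * K) * norm (P t N x - flow T t x)) \<longlonglongrightarrow> 0"
        by (intro tendsto_mult_right_zero tendsto_norm_zero)
    qed
  qed
  moreover have "(\<lambda>N. P s N (P t N x)) \<longlonglongrightarrow> flow T (s + t) x"
  proof (rule Lim_transform[OF Plim[of "s + t" x]])
    define a b where "a = \<bar>s\<bar> * K" and "b = \<bar>t\<bar> * K"
    have a0: "0 \<le> a" "0 \<le> b" using K by (auto simp: a_def b_def)
    define A where "A N = {..<N} \<times> {..<N} - {(m, n). m + n < (N::nat)}" for N
    have sub: "{(m, n). m + n < N} \<subseteq> {..<N} \<times> {..<N}" for N :: nat by auto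
    have fin: "finite ({..<N} \<times> {..<N})" for N :: nat by simp
    have prod: "P s N (P t N x) = (\<Sum>(m, n)\<in>{..<N} \<times> {..<N}. (e s m * e t n) *\<^sub>R (T ^^ (m + n)) x)" for N
    proof -
      have "(T ^^ m) (P t N x) = (\<Sum>n<N. e t n *\<^sub>R (T ^^ (m + n)) x)" for m
        unfolding P_def
        by (simp add: linear_sum[OF bounded_linear.linear[OF bounded_linear_funpow[OF T]]]
            linear_simps(5)[OF bounded_linear_funpow[OF T]] funpow_add)
      then have "P s N (P t N x) = (\<Sum>m<N. \<Sum>n<N. (e s m * e t n) *\<^sub>R (T ^^ (m + n)) x)"
        by (subst P_def) (simp add: scaleR_sum_right)
      then show ?thesis by (simp add: sum.cartesian_product)
    qed
    have tri: "P (s + t) N x = (\<Sum>(m, n)\<in>{(m, n). m + n < N}. (e s m * e t n) *\<^sub>R (T ^^ (m + n)) x)" for N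
      unfolding P_def esum[symmetric]
      by (subst sum.triangle_reindex) (simp add: scaleR_sum_left)
    have diff: "P s N (P t N x) - P (s + t) N x = (\<Sum>(m, n)\<in>A N. (e s m * e t n) *\<^sub>R (T ^^ (m + n)) x)" for N
      unfolding prod tri A_def by (rule sum_diff[OF fin sub, symmetric])
    define E where "E N = (\<Sum>(m, n)\<in>A N. e a m * e b n)" for N
    have E: "E N = (\<Sum>m<N. e a m) * (\<Sum>n<N. e b n) - (\<Sum>n<N. e (a + b) n)" for N
    proof -
      have "(\<Sum>n<N. e (a + b) n) = (\<Sum>(m, n)\<in>{(m, n). m + n < N}. e a m * e b n)"
        unfolding esum[symmetric] by (rule sum.triangle_reindex[symmetric])
      moreover have "(\<Sum>m<N. e a m) * (\<Sum>n<N. e b n) = (\<Sum>(m, n)\<in>{..<N} \<times> {..<N}. e a m * e b n)"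
        by (simp add: sum_product sum.cartesian_product)
      ultimately show ?thesis unfolding E_def A_def by (simp add: sum_diff[OF fin sub])
    qed
    have "E \<longlonglongrightarrow> exp a * exp b - exp (a + b)"
      unfolding E[abs_def] by (intro tendsto_intros elim)
    then have E0: "E \<longlonglongrightarrow> 0" by (simp add: exp_add)
    show "(\<lambda>N. P s N (P t N x) - P (s + t) N x) \<longlonglongrightarrow> 0"
    proof (rule Lim_null_comparison)
      show "(\<lambda>N. E N * norm x) \<longlonglongrightarrow> 0" by (rule tendsto_mult_left_zero[OF E0])
      show "\<forall>\<^sub>F N in sequentially. norm (P s N (P t N x) - P (s + t) N x) \<le> E N * norm x"
      proof (rule always_eventually, rule allI)
        fix N
        have "norm (P s N (P t N x) - P (s + t) N x)
            \<le> (\<Sum>(m, n)\<in>A N. norm ((e s m * e t n) *\<^sub>R (T ^^ (m + n)) x))"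
          unfolding diff by (rule order_trans[OF norm_sum]) (simp add: case_prod_unfold)
        also have "\<dots> \<le> (\<Sum>(m, n)\<in>A N. (e a m * e b n) * norm x)"
        proof (rule sum_mono, clarify)
          fix m n
          have "norm ((e s m * e t n) *\<^sub>R (T ^^ (m + n)) x)
              \<le> (\<bar>e s m\<bar> * \<bar>e t n\<bar>) * (K ^ (m + n) * norm x)"
            using norm_funpow_le[OF K(2) K'(1), of "m + n" x]
            by (simp add: abs_mult mult_left_mono)
          also have "\<dots> = (e a m * e b n) * norm x"
            by (simp add: e_def a_def b_def abs_mult power_abs power_mult_distrib power_add)
          finally show "norm ((e s m * e t n) *\<^sub>R (T ^^ (m + n)) x) \<le> (e a m * e b n) * norm x" .
        qed
        also have "\<dots> = E N * norm x"
          unfolding E_def by (simp add: sum_distrib_right case_prod_unfold)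
        finally show "norm (P s N (P t N x) - P (s + t) N x) \<le> E N * norm x" .
      qed
    qed
  qed
  ultimately show ?thesis using LIMSEQ_unique by blast
qed

lemma flow_zero: "bounded_linear T \<Longrightarrow> flow T 0 x = x"
  using norm_flow_le flow_first_order[of _ T 0 x] ex_norm_bound[of T]
  by (metis bounded_linear.pos_bounded[of T] abs_zero diff_zero eq_iff_diff_eq_0 less_imp_le
      mult_zero_left norm_le_zero_iff power_zero_numeral scaleR_zero_left)

lemma flow_of_nat:
  fixes T :: "'a::banach \<Rightarrow> 'a"
  assumes "bounded_linear T"
  shows "flow T (real n * h) x = (flow T h ^^ n) x"
  by (induction n) (simp_all add: flow_zero[OF assms] distrib_right flow_add[OF assms])

context complex_banach
begin

lemma bounded_linear_scaleC: "bounded_linear (\<lambda>x. c *\<^sub>C x)"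
  by (rule bounded_linear_intro[where K = "cmod c"])
    (simp_all add: scale_right_distrib scaleR_eq_scaleC mult.commute norm_scaleC)

lemma flow_clinear:
  assumes T: "bounded_clinear scaleC T"
  shows "bounded_clinear scaleC (flow T t)"
proof -
  have bl: "bounded_linear T" using T by (simp add: bounded_clinear_def)
  obtain K where K: "0 < K" "\<And>x. norm (T x) \<le> K * norm x" using ex_norm_bound[OF bl] by blast
  have pow: "(T ^^ n) (c *\<^sub>C x) = c *\<^sub>C (T ^^ n) x" for n c x
    by (induction n) (simp_all add: bounded_clinearD(2)[OF T])
  show ?thesis
  proof (rule bounded_clinearI)
    show "flow T t (x + y) = flow T t x + flow T t y" for x y
    proof (rule sums_unique2[OF flow_sums[OF bl]])
      show "(\<lambda>n. (t ^ n /\<^sub>R fact n) *\<^sub>R (T ^^ n) (x + y)) sums (flow T t x + flow T t y)"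
        using sums_add[OF flow_sums[OF bl, of t x] flow_sums[OF bl, of t y]]
        by (simp add: linear_simps(1)[OF bounded_linear_funpow[OF bl]] scaleR_right_distrib)
    qed
    show "flow T t (c *\<^sub>C x) = c *\<^sub>C flow T t x" for c x
    proof (rule sums_unique2[OF flow_sums[OF bl]])
      show "(\<lambda>n. (t ^ n /\<^sub>R fact n) *\<^sub>R (T ^^ n) (c *\<^sub>C x)) sums (c *\<^sub>C flow T t x)"
        using bounded_linear.sums[OF bounded_linear_scaleC flow_sums[OF bl, of t x], of c]
        by (simp add: pow scaleR_eq_scaleC mult.commute)
    qed
    show "norm (flow T t x) \<le> exp (\<bar>t\<bar> * K) * norm x" for x
      using norm_flow_le[of K T t x] K by simp
  qed
qed

text \<open>Over a short time \<open>h\<close> the norm grows by a factor \<open>1 + O(h\<^sup>2)\<close>, again by testing with a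
  functional supporting at the end point; subdividing the time removes the error.\<close>

lemma flow_contractive:
  assumes T: "bounded_clinear scaleC T"
    and dis: "\<And>\<phi> x. supports \<phi> x \<Longrightarrow> Re (\<phi> (T x)) \<le> 0"
    and t: "0 \<le> t"
  shows "norm (flow T t x) \<le> norm x"
proof -
  have bl: "bounded_linear T" using T by (simp add: bounded_clinear_def)
  obtain K where K: "0 < K" "\<And>x. norm (T x) \<le> K * norm x" using ex_norm_bound[OF bl] by blast
  define C where "C = K\<^sup>2 * (1 + exp (t * K))"
  have C: "0 \<le> C" by (simp add: C_def)
  have step: "norm (flow T h y) \<le> (1 + C * h\<^sup>2) * norm y" if h: "0 \<le> h" "h \<le> t" for h y
  proof -
    define w where "w = y + h *\<^sub>R T y"
    obtain \<phi> where \<phi>: "supports \<phi> w" using ex_supports by blast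
    have w_eq: "w = y + h *\<^sub>R T w - (h * h) *\<^sub>R T (T y)"
      by (simp add: w_def bounded_clinearD(1,4)[OF T] scaleR_right_distrib)
    have "norm w = Re (\<phi> w)" by (simp add: supports_self[OF \<phi>])
    also have "\<dots> = Re (\<phi> (y + h *\<^sub>R T w - (h * h) *\<^sub>R T (T y)))"
      using arg_cong[OF w_eq, of "\<lambda>x. Re (\<phi> x)"] .
    also have "\<dots> = Re (\<phi> y) + h * Re (\<phi> (T w)) - (h * h) * Re (\<phi> (T (T y)))"
      by (simp add: supports_add[OF \<phi>] supports_diff[OF \<phi>] supports_scaleR[OF \<phi>])
    also have "\<dots> \<le> norm y + 0 + (h * h) * (K * (K * norm y))"
    proof -
      have "- Re (\<phi> (T (T y))) \<le> norm (T (T y))"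
        using supports_Re_le[OF \<phi>, of "- T (T y)"] by (simp add: supports_minus[OF \<phi>])
      also have "\<dots> \<le> K * (K * norm y)"
        using K(2)[of "T y"] mult_left_mono[OF K(2)[of y] less_imp_le[OF K(1)]] by linarith
      finally have "(h * h) * - Re (\<phi> (T (T y))) \<le> (h * h) * (K * (K * norm y))"
        by (rule mult_left_mono) simp
      moreover have "h * Re (\<phi> (T w)) \<le> 0" using h dis[OF \<phi>] by (simp add: mult_le_0_iff)
      ultimately show ?thesis using supports_Re_le[OF \<phi>, of y] by simp
    qed
    finally have w: "norm w \<le> norm y + (h * h) * (K * (K * norm y))" by simp
    have "norm (flow T h y - y - h *\<^sub>R T y) \<le> (\<bar>h\<bar> * K)\<^sup>2 * exp (\<bar>h\<bar> * K) * norm y"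
      by (rule flow_first_order) (use K in auto)
    also have "\<dots> \<le> (h * K)\<^sup>2 * exp (t * K) * norm y"
      using h K by (intro mult_right_mono mult_mono) (auto simp: mult_right_mono)
    finally have "norm (flow T h y - w) \<le> (h * K)\<^sup>2 * exp (t * K) * norm y"
      by (simp add: w_def algebra_simps)
    then have "norm (flow T h y) \<le> norm w + (h * K)\<^sup>2 * exp (t * K) * norm y"
      using norm_triangle_sub[of "flow T h y" w] by linarith
    with w have "norm (flow T h y) \<le> norm y + (h * h) * (K * (K * norm y)) + (h * K)\<^sup>2 * exp (t * K) * norm y"
      by linarith
    then show ?thesis by (simp add: C_def power2_eq_square algebra_simps)
  qed
  have sub: "norm (flow T t x) \<le> exp (C * t\<^sup>2 / real n) * norm x" if n: "0 < n" for n :: nat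
  proof -
    define h where "h = t / real n"
    have h: "0 \<le> h" "h \<le> t" "real n * h = t"
      using t n by (auto simp: h_def divide_le_eq mult_le_cancel_left1)
    have "norm ((flow T h ^^ n) x) \<le> (1 + C * h\<^sup>2) ^ n * norm x"
      by (rule norm_funpow_le) (use step h C in auto)
    also have "\<dots> \<le> exp (C * h\<^sup>2) ^ n * norm x"
      using C by (intro mult_right_mono power_mono exp_ge_add_one_self) auto
    also have "exp (C * h\<^sup>2) ^ n = exp (C * t\<^sup>2 / real n)"
      unfolding exp_of_nat_mult[symmetric] using n by (simp add: h_def power2_eq_square)
    finally show ?thesis using flow_of_nat[OF bl, of n h x] h(3) by simp
  qed
  have "(\<lambda>n. exp (C * t\<^sup>2 / real n) * norm x) \<longlonglongrightarrow> exp 0 * norm x"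
    by (intro tendsto_intros lim_const_over_n)
  moreover have "\<forall>\<^sub>F n in sequentially. norm (flow T t x) \<le> exp (C * t\<^sup>2 / real n) * norm x"
    using eventually_gt_at_top[of 0] by eventually_elim (rule sub)
  ultimately have "norm (flow T t x) \<le> exp 0 * norm x"
    by (rule tendsto_lowerbound) simp
  then show ?thesis by simp
qed

section \<open>Polynomial maps and tangential quadratic fields\<close>

text \<open>Averaging a polynomial against \<open>\<zeta>\<^bsup>-j\<^esup>\<close> over the roots of unity extracts its
  \<open>j\<close>-th coefficient.\<close>

lemma coefficient_bound:
  assumes P: "\<And>\<zeta>. cmod \<zeta> = 1 \<Longrightarrow> norm (\<Sum>i\<le>d. \<zeta> ^ i *\<^sub>C a i) \<le> B" and j: "j \<le> d"
  shows "norm (a j) \<le> B"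
proof -
  obtain \<phi> where \<phi>: "supports \<phi> (a j)" using ex_supports by blast
  define N where "N = Suc d"
  define e where "e m = exp (2 * of_real pi * \<i> * of_nat m / of_nat N)" for m :: nat
  have N: "1 \<le> N" "N \<noteq> 0" by (simp_all add: N_def)
  have norm_e: "cmod (e m) = 1" for m
    unfolding e_def by (simp add: norm_exp_eq_Re)
  have e0: "e m \<noteq> 0" for m by (simp add: e_def)
  have e_swap: "e m ^ i = e i ^ m" for m i
    by (simp add: e_def exp_of_nat_mult[symmetric] field_simps)
  have eN: "e m ^ N = 1" for m
  proof -
    have "e m ^ N = exp (2 * of_real pi * \<i> * of_nat m)"
      using N by (simp add: e_def exp_of_nat_mult[symmetric])
    also have "\<dots> = exp (2 * of_real pi * \<i>) ^ m"
      by (simp add: exp_of_nat_mult[symmetric] mult_ac)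
    finally show ?thesis by (simp add: exp_two_pi_i mult_ac)
  qed
  have orth: "(\<Sum>m<N. (e i / e j) ^ m) = (if i = j then of_nat N else 0)" if "i \<le> d" for i
  proof (cases "i = j")
    case True
    then show ?thesis using e0 by simp
  next
    case False
    have "e i \<noteq> e j"
      unfolding e_def using complex_root_unity_eq[OF N(1), of i j] that j False by (simp add: N_def)
    then have "e i / e j \<noteq> 1" using e0 by simp
    then show ?thesis
      using False geometric_sum[of "e i / e j" N] by (simp add: power_divide eN)
  qed
  have "of_nat N * \<phi> (a j) = (\<Sum>i\<le>d. \<phi> (a i) * (\<Sum>m<N. (e i / e j) ^ m))"
    using j by (simp add: orth if_distrib[of "\<lambda>t. _ * t"] sum.delta' mult.commute cong: if_cong)
  also have "\<dots> = (\<Sum>m<N. \<Sum>i\<le>d. \<phi> (a i) * (e i / e j) ^ m)"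
    unfolding sum_distrib_left by (rule sum.swap)
  also have "\<dots> = (\<Sum>m<N. inverse (e m ^ j) * \<phi> (\<Sum>i\<le>d. e m ^ i *\<^sub>C a i))"
  proof (rule sum.cong[OF refl])
    fix m
    have lin: "\<phi> (\<Sum>i\<in>I. f i) = (\<Sum>i\<in>I. \<phi> (f i))" for f :: "nat \<Rightarrow> 'a" and I
      by (induction I rule: infinite_finite_induct)
        (simp_all add: supports_zero[OF \<phi>] supports_add[OF \<phi>])
    show "(\<Sum>i\<le>d. \<phi> (a i) * (e i / e j) ^ m) = inverse (e m ^ j) * \<phi> (\<Sum>i\<le>d. e m ^ i *\<^sub>C a i)"
      by (simp add: lin supports_scaleC[OF \<phi>] sum_distrib_left power_divide e_swap[of m] field_simps)
  qed
  finally have "real N * cmod (\<phi> (a j)) = cmod (\<Sum>m<N. inverse (e m ^ j) * \<phi> (\<Sum>i\<le>d. e m ^ i *\<^sub>C a i))"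
    by (metis norm_mult norm_of_nat)
  also have "\<dots> \<le> (\<Sum>m<N. cmod (inverse (e m ^ j) * \<phi> (\<Sum>i\<le>d. e m ^ i *\<^sub>C a i)))"
    by (rule norm_sum)
  also have "\<dots> \<le> (\<Sum>m<N. B)"
  proof (rule sum_mono)
    fix m
    show "cmod (inverse (e m ^ j) * \<phi> (\<Sum>i\<le>d. e m ^ i *\<^sub>C a i)) \<le> B"
      using supports_bound[OF \<phi>, of "\<Sum>i\<le>d. e m ^ i *\<^sub>C a i"] P[OF norm_e, of m]
      by (simp add: norm_mult norm_inverse norm_power norm_e)
  qed
  finally have "real N * cmod (\<phi> (a j)) \<le> real N * B" by simp
  then have "cmod (\<phi> (a j)) \<le> B" using N by simp
  then show ?thesis by (simp add: supports_self[OF \<phi>])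
qed

text \<open>A quadratic vector field that is tangent to all spheres vanishes.  Its Euler scheme with step
  \<open>h = s / n\<close> consists of polynomial maps that stay bounded on the unit ball up to any time \<open>s\<close>,
  while the second-order coefficient of the \<open>n\<close>-th iterate is \<open>s\<close> times the field; the coefficient
  bound then forces the field to be zero.\<close>

lemma tangential_quadratic_zero:
  assumes addl: "\<And>x y z. b (x + y) z = b x z + b y z" and addr: "\<And>x y z. b x (y + z) = b x y + b x z"
    and scl: "\<And>c x y. b (c *\<^sub>C x) y = c *\<^sub>C b x y" and scr: "\<And>c x y. b x (c *\<^sub>C y) = c *\<^sub>C b x y"
    and bd: "\<And>x y. norm (b x y) \<le> C * norm x * norm y"
    and tan: "\<And>\<phi> z. supports \<phi> z \<Longrightarrow> \<phi> (b z z) = 0"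
  shows "b z z = 0"
proof -
  define C1 where "C1 = \<bar>C\<bar> + 1"
  have C1: "0 < C1" by (simp add: C1_def)
  have bd: "norm (b x y) \<le> C1 * (norm x * norm y)" for x y
  proof -
    have "C * (norm x * norm y) \<le> C1 * (norm x * norm y)"
      by (rule mult_right_mono) (auto simp: C1_def)
    then show ?thesis using bd[of x y] by (simp add: mult.assoc)
  qed
  have diffl: "b (x - y) z = b x z - b y z" for x y z
    using addl[of "x - y" y z] by simp
  have diffr: "b x (y - z) = b x y - b x z" for x y z
    using addr[of x "y - z" z] by simp
  have zl: "b 0 y = 0" and zr: "b y 0 = 0" for y
    using diffl[of 0 0 y] diffr[of y 0 0] by simp_all
  have suml: "b (sum f I) y = (\<Sum>i\<in>I. b (f i) y)" and sumr: "b y (sum f I) = (\<Sum>i\<in>I. b y (f i))"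
    for f :: "nat \<Rightarrow> 'a" and I y
    by (induction I rule: infinite_finite_induct) (simp_all add: zl zr addl addr)
  define D where "D = 16 * C1\<^sup>2 * (1 + C1)"
  have D: "0 < D" using C1 by (simp add: D_def)
  have step: "norm (x + h *\<^sub>R b x x) \<le> norm x + h\<^sup>2 * D"
    if x: "norm x \<le> 2" and h: "0 \<le> h" "h \<le> 1" for x h
  proof -
    define w where "w = x + h *\<^sub>R b x x"
    obtain \<phi> where \<phi>: "supports \<phi> w" using ex_supports by blast
    have xx: "norm (b x x) \<le> 4 * C1"
    proof -
      have "norm x * norm x \<le> 2 * 2" using x by (intro mult_mono) auto
      then have "C1 * (norm x * norm x) \<le> C1 * 4" using C1 by (intro mult_left_mono) auto
      then show ?thesis using bd[of x x] by simp
    qed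
    have xw: "norm (x - w) \<le> h * (4 * C1)"
      using h xx by (simp add: w_def mult_left_mono)
    have "h * (4 * C1) \<le> 4 * C1" using h C1 by simp
    then have wn: "norm w \<le> 2 + 4 * C1"
      using norm_triangle_ineq4[of x "x - w"] x xw by simp
    have "b x x - b w w = b (x - w) x + b w (x - w)" by (simp add: diffl diffr)
    then have "norm (b x x - b w w) \<le> C1 * (norm (x - w) * norm x) + C1 * (norm w * norm (x - w))"
      using norm_triangle_le[OF add_mono[OF bd[of "x - w" x] bd[of w "x - w"]]] by simp
    also have "\<dots> \<le> C1 * ((h * (4 * C1)) * 2) + C1 * ((2 + 4 * C1) * (h * (4 * C1)))"
      using x xw wn C1 h by (intro add_mono mult_left_mono mult_mono) auto
    also have "\<dots> = h * D" by (simp add: D_def power2_eq_square algebra_simps)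
    finally have bb: "norm (b x x - b w w) \<le> h * D" .
    have "norm w = Re (\<phi> w)" by (simp add: supports_self[OF \<phi>])
    also have "\<dots> = Re (\<phi> x + h * \<phi> (b x x))"
      by (subst w_def) (simp add: supports_add[OF \<phi>] supports_scaleR[OF \<phi>])
    also have "\<phi> (b x x) = \<phi> (b x x - b w w)" by (simp add: supports_diff[OF \<phi>] tan[OF \<phi>])
    also have "Re (\<phi> x + h * \<phi> (b x x - b w w)) \<le> norm x + h * (h * D)"
      using supports_Re_le[OF \<phi>, of x] supports_Re_le[OF \<phi>, of "b x x - b w w"] bb h
      by (simp add: add_mono mult_left_mono)
    finally show ?thesis by (simp add: w_def power2_eq_square)
  qed
  have unit: "b z z = 0" if z: "norm z \<le> 1" for z
  proof -
    have main: "s * norm (b z z) \<le> 2" if s: "0 < s" for s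
    proof -
      obtain n :: nat where n: "max 1 (max s (s\<^sup>2 * D)) < real n" using reals_Archimedean2 by blast
      define h where "h = s / real n"
      have n0: "0 < real n" using n by simp
      have h: "0 < h" "h \<le> 1" "real n * h = s" using n n0 s by (simp_all add: h_def)
      have small: "real n * (h\<^sup>2 * D) \<le> 1"
      proof -
        have "real n * (h\<^sup>2 * D) = s\<^sup>2 * D / real n"
          using n0 by (simp add: h_def power2_eq_square)
        then show ?thesis using n n0 by simp
      qed
      define a where "a = rec_nat (\<lambda>j::nat. if j = 1 then z else 0)
        (\<lambda>_ a j. a j + h *\<^sub>R (\<Sum>i\<le>j. b (a i) (a (j - i))))"
      have a0: "a 0 = (\<lambda>j. if j = 1 then z else 0)"
        and aS: "a (Suc k) = (\<lambda>j. a k j + h *\<^sub>R (\<Sum>i\<le>j. b (a k i) (a k (j - i))))" for k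
        by (simp_all add: a_def)
      have deg: "a k j = 0" if "2 ^ k < j" for k j
        using that
      proof (induction k arbitrary: j)
        case 0
        then show ?case by (simp add: a0)
      next
        case (Suc k)
        have "b (a k i) (a k (j - i)) = 0" if "i \<le> j" for i
        proof (cases "2 ^ k < i")
          case True
          then show ?thesis using Suc.IH zl by simp
        next
          case False
          then have "2 ^ k < j - i" using Suc.prems by simp
          then show ?thesis using Suc.IH zr by simp
        qed
        moreover have "a k j = 0" using Suc by simp
        ultimately show ?case by (simp add: aS)
      qed
      have low: "a k 0 = 0 \<and> a k 1 = z \<and> a k 2 = (real k * h) *\<^sub>R b z z" for k
        by (induction k) (auto simp: a0 aS zl zr numeral_2_eq_2 distrib_right scaleR_left_distrib)
      define x where "x k \<zeta> = (\<Sum>j\<le>2 ^ k. \<zeta> ^ j *\<^sub>C a k j)" for k \<zeta>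
      have x0: "x 0 \<zeta> = \<zeta> *\<^sub>C z" for \<zeta>
        by (simp add: x_def a0)
      have xS: "x (Suc k) \<zeta> = x k \<zeta> + h *\<^sub>R b (x k \<zeta>) (x k \<zeta>)" for k \<zeta>
      proof -
        let ?d = "2 ^ k :: nat"
        have d2: "2 ^ Suc k = ?d + ?d" by simp
        define g where "g i j = \<zeta> ^ (i + j) *\<^sub>C b (a k i) (a k j)" for i j
        have "b (x k \<zeta>) (x k \<zeta>) = (\<Sum>i\<le>?d. \<Sum>j\<le>?d. g i j)"
          by (subst sum.swap)
            (simp add: x_def suml sumr scl scr g_def power_add scale_sum_right mult.commute)
        also have "\<dots> = (\<Sum>(i, j)\<in>{..?d} \<times> {..?d}. g i j)"
          by (simp add: sum.cartesian_product)
        also have "\<dots> = (\<Sum>(i, j)\<in>{(i, j). i + j \<le> ?d + ?d}. g i j)"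
        proof (rule sum.mono_neutral_left)
          show "finite {(i, j). i + j \<le> ?d + ?d}"
            by (rule finite_subset[of _ "{..?d + ?d} \<times> {..?d + ?d}"]) auto
          show "\<forall>p\<in>{(i, j). i + j \<le> ?d + ?d} - {..?d} \<times> {..?d}. (case p of (i, j) \<Rightarrow> g i j) = 0"
            by (auto simp: g_def) (metis deg zl not_le, metis deg zr not_le)
        qed auto
        also have "\<dots> = (\<Sum>r\<le>?d + ?d. \<Sum>i\<le>r. g i (r - i))"
          by (rule sum.triangle_reindex_eq)
        also have "\<dots> = (\<Sum>r\<le>?d + ?d. \<zeta> ^ r *\<^sub>C (\<Sum>i\<le>r. b (a k i) (a k (r - i))))"
          by (simp add: g_def scale_sum_right)
        finally have b: "b (x k \<zeta>) (x k \<zeta>)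
            = (\<Sum>r\<le>?d + ?d. \<zeta> ^ r *\<^sub>C (\<Sum>i\<le>r. b (a k i) (a k (r - i))))" .
        have xk: "x k \<zeta> = (\<Sum>j\<le>?d + ?d. \<zeta> ^ j *\<^sub>C a k j)"
          unfolding x_def by (rule sum.mono_neutral_left) (use deg in auto)
        have "x (Suc k) \<zeta> = (\<Sum>j\<le>?d + ?d. \<zeta> ^ j *\<^sub>C a k j)
            + h *\<^sub>R (\<Sum>r\<le>?d + ?d. \<zeta> ^ r *\<^sub>C (\<Sum>i\<le>r. b (a k i) (a k (r - i))))"
          unfolding x_def d2 aS
          by (simp add: scale_right_distrib sum.distrib scaleR_eq_scaleC scale_sum_right mult.commute)
        then show ?thesis unfolding b[symmetric] xk[symmetric] .
      qed
      have grow: "norm (x k \<zeta>) \<le> 1 + real k * (h\<^sup>2 * D)" if \<zeta>: "cmod \<zeta> = 1" and k: "k \<le> n" for k \<zeta>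
        using k
      proof (induction k)
        case 0
        then show ?case using z \<zeta> by (simp add: x0 norm_scaleC)
      next
        case (Suc k)
        have "real k * (h\<^sup>2 * D) \<le> real n * (h\<^sup>2 * D)"
          using Suc.prems D by (intro mult_right_mono) auto
        then have "norm (x k \<zeta>) \<le> 2" using Suc small by simp
        then have "norm (x (Suc k) \<zeta>) \<le> norm (x k \<zeta>) + h\<^sup>2 * D"
          unfolding xS by (rule step) (use h in auto)
        then show ?case using Suc by (simp add: distrib_right)
      qed
      have "norm (a n 2) \<le> 2"
      proof (rule coefficient_bound[where d = "2 ^ n"])
        show "norm (\<Sum>i\<le>2 ^ n. \<zeta> ^ i *\<^sub>C a n i) \<le> 2" if "cmod \<zeta> = 1" for \<zeta>
          using grow[OF that order_refl] small by (simp add: x_def)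
        have "2 ^ 1 \<le> (2 ^ n :: nat)" using n by (intro power_increasing) auto
        then show "2 \<le> (2 ^ n :: nat)" by simp
      qed
      then show ?thesis using low[of n] h s by simp
    qed
    show ?thesis
    proof (rule ccontr)
      assume "b z z \<noteq> 0"
      then show False using main[of "3 / norm (b z z)"] by simp
    qed
  qed
  show ?thesis
  proof (cases "z = 0")
    case True
    then show ?thesis by (simp add: zl)
  next
    case False
    have "b (of_real (inverse (norm z)) *\<^sub>C z) (of_real (inverse (norm z)) *\<^sub>C z) = 0"
      using False by (intro unit) (simp add: norm_scaleC norm_inverse)
    then show ?thesis using False by (simp add: scl scr)
  qed
qed

end

section \<open>The triple product\<close>

context jb_star_triple
begin

lemma triple_add_right: "triple x y (z + z') = triple x y z + triple x y z'"
  using triple_add_left[of z z' y x] by (simp add: triple_commute)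

lemma triple_scale_right: "triple x y (c *\<^sub>C z) = c *\<^sub>C triple x y z"
  using triple_scale_left[of c z y x] by (simp add: triple_commute)

lemma triple_scaleR: "triple (r *\<^sub>R x) y z = r *\<^sub>R triple x y z"
  "triple x (r *\<^sub>R y) z = r *\<^sub>R triple x y z" "triple x y (r *\<^sub>R z) = r *\<^sub>R triple x y z"
  by (simp_all add: scaleR_eq_scaleC triple_scale_left triple_scale_middle triple_scale_right)

lemma triple_zero: "triple 0 y z = 0" "triple x 0 z = 0" "triple x y 0 = 0"
  using triple_scaleR(1)[of 0 0 y z] triple_scaleR(2)[of x 0 0 z] triple_scaleR(3)[of x y 0 0]
  by simp_all

lemma triple_diff: "triple (x - x') y z = triple x y z - triple x' y z"
  "triple x (y - y') z = triple x y z - triple x y' z"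
  "triple x y (z - z') = triple x y z - triple x y z'"
proof -
  show "triple (x - x') y z = triple x y z - triple x' y z"
    using triple_add_left[of "x - x'" x' y z] by simp
  show "triple x (y - y') z = triple x y z - triple x y' z"
    using triple_add_middle[of x "y - y'" y' z] by simp
  show "triple x y (z - z') = triple x y z - triple x y z'"
    using triple_add_right[of x y "z - z'" z'] by simp
qed

lemmas triple_linear = triple_add_left triple_add_middle triple_add_right triple_diff
  triple_scaleR triple_zero

text \<open>A trilinear map is bounded as soon as it is continuous at the origin.\<close>

lemma ex_triple_bound: "\<exists>M\<ge>1. \<forall>x y z. norm (triple x y z) \<le> M * norm x * norm y * norm z"
proof -
  have "isCont (\<lambda>(x, y, z). triple x y z) (0, 0, 0)"
    using triple_continuous by (simp add: continuous_on_eq_continuous_at)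
  then obtain d where d: "0 < d"
    and small: "\<And>p. dist p (0, 0, 0) < d \<Longrightarrow> dist (case p of (x, y, z) \<Rightarrow> triple x y z) 0 < 1"
    unfolding continuous_at_eps_delta by (metis (mono_tags, lifting) case_prod_conv triple_zero(1) zero_less_one)
  define r where "r = d / 4"
  have r: "0 < r" using d by (simp add: r_def)
  have bound: "norm (triple x y z) \<le> (1 / r ^ 3) * norm x * norm y * norm z" for x y z
  proof (cases "x = 0 \<or> y = 0 \<or> z = 0")
    case True
    then show ?thesis using r by (auto simp: triple_zero)
  next
    case False
    define u v w where "u = (r / norm x) *\<^sub>R x" and "v = (r / norm y) *\<^sub>R y"
      and "w = (r / norm z) *\<^sub>R z"
    have n: "norm u = r" "norm v = r" "norm w = r" using False r by (simp_all add: u_def v_def w_def)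
    have "norm (u, v, w) \<le> norm u + norm (v, w)" by (rule norm_Pair_le)
    also have "\<dots> \<le> norm u + (norm v + norm w)" by (intro add_left_mono norm_Pair_le)
    also have "\<dots> < d" using n d by (simp add: r_def)
    finally have "norm (triple u v w) < 1"
      using small[of "(u, v, w)"] by (simp add: dist_norm zero_prod_def[symmetric])
    moreover have "norm (triple u v w) = (r ^ 3 / (norm x * norm y * norm z)) * norm (triple x y z)"
      using r by (simp add: u_def v_def w_def triple_scaleR power3_eq_cube mult_ac)
    ultimately have "(r ^ 3 / (norm x * norm y * norm z)) * norm (triple x y z) < 1" by simp
    then show ?thesis using False r by (simp add: field_simps)
  qed
  define M where "M = max 1 (1 / r ^ 3)"
  have "norm (triple x y z) \<le> M * norm x * norm y * norm z" for x y z
  proof -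
    have "(1 / r ^ 3) * norm x * norm y * norm z \<le> M * norm x * norm y * norm z"
      by (intro mult_right_mono) (auto simp: M_def)
    then show ?thesis using bound[of x y z] by simp
  qed
  then show ?thesis by (intro exI[of _ M]) (simp add: M_def)
qed

definition triple_const :: real where
  "triple_const = (SOME M. 1 \<le> M \<and> (\<forall>x y z. norm (triple x y z) \<le> M * norm x * norm y * norm z))"

lemma triple_const_ge_1: "1 \<le> triple_const"
  and norm_triple_le: "norm (triple x y z) \<le> triple_const * norm x * norm y * norm z"
  using someI_ex[OF ex_triple_bound] unfolding triple_const_def by auto

lemma norm_triple_le': 
  assumes "norm x \<le> a" "norm y \<le> b" "norm z \<le> c"
  shows "norm (triple x y z) \<le> triple_const * a * b * c"
proof -
  have "0 \<le> a" "0 \<le> b"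
    using assms norm_ge_zero[of x] norm_ge_zero[of y] by linarith+
  then have "triple_const * norm x * norm y * norm z \<le> triple_const * a * b * c"
    using assms triple_const_ge_1 by (intro mult_mono) auto
  then show ?thesis using norm_triple_le[of x y z] by simp
qed

lemma bounded_clinear_triple: "bounded_clinear scaleC (triple a b)"
  by (rule bounded_clinearI[where K = "triple_const * norm a * norm b"])
    (simp_all add: triple_add_right triple_scale_right norm_triple_le)

text \<open>The two instances of the Jordan identity for \<open>{x, y, {x, w, x}}\<close> and \<open>{x, w, {x, y, x}}\<close>
  determine both of these elements.\<close>

lemma box_quadratic: "triple x y (triple x w x) = triple x (triple y x w) x"
proof -
  let ?A = "triple x y (triple x w x)" and ?B = "triple x w (triple x y x)"
    and ?Z = "triple x (triple y x w) x"
  have A: "?A = ?B - ?Z + ?B"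
    using jordan_identity[of x y x w x] by (simp add: triple_commute[of "triple x y x"])
  have B: "?B = ?A - ?Z + ?A"
    using jordan_identity[of x w x y x]
    by (simp add: triple_commute[of "triple x w x"] triple_commute[of w x y])
  define d where "d = ?A - ?Z"
  have "d = (?B - ?Z) + (?B - ?Z)" using A by (simp add: d_def)
  moreover have "?B - ?Z = d + d" using B by (simp add: d_def)
  ultimately have "d = 2 *\<^sub>R (2 *\<^sub>R d)" by (simp only: scaleR_2)
  then have "d = 0" using scaleR_cancel_right[of 1 d 4] by simp
  then show ?thesis by (simp add: d_def)
qed

lemma box_commutator:
  "triple a b (triple x y w) - triple x y (triple a b w) = triple (triple a b x) y w - triple x (triple b a y) w"
  using jordan_identity[of a b x y w] by simp

section \<open>Odd powers\<close>

definition odd_power :: "'a \<Rightarrow> nat \<Rightarrow> 'a" where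
  "odd_power z n = (triple z z ^^ n) z"

lemma odd_power_0 [simp]: "odd_power z 0 = z"
  and odd_power_Suc: "odd_power z (Suc n) = triple z z (odd_power z n)"
  by (simp_all add: odd_power_def)

text \<open>If all operators \<open>L(z\<^sub>i, z\<^sub>j)\<close> with \<open>i + j = N\<close> agree and commute with \<open>L(z, z)\<close>,
  then the commutators of \<open>L(z, z)\<close> with them show that those with \<open>i + j = N + 1\<close> agree. Their
  commutator \<open>D\<close> with \<open>L(z, z)\<close> vanishes because computing it in the other order gives
  \<open>- D = (N + 2) D\<close>.\<close>

lemma odd_power_induction:
  "(\<forall>i j x. i + j = N \<longrightarrow> triple (odd_power z i) (odd_power z j) x = triple (odd_power z N) z x) \<and>
   (\<forall>x. triple z z (triple (odd_power z N) z x) = triple (odd_power z N) z (triple z z x))"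
proof (induction N)
  case 0
  then show ?case by simp
next
  case (Suc N)
  note IH = Suc
  let ?c = "odd_power z"
  have shift: "triple (?c (Suc k)) (?c l) w - triple (?c k) (?c (Suc l)) w
      = triple z z (triple (?c k) (?c l) w) - triple (?c k) (?c l) (triple z z w)" for k l w
    by (simp add: box_commutator odd_power_Suc)
  have eq: "triple (?c i) (?c j) x = triple (?c (Suc N)) z x" if "i + j = Suc N" for i j x
    using that
  proof (induction j arbitrary: i)
    case 0
    then show ?case by simp
  next
    case (Suc j)
    then have "i + j = N" by simp
    then have "triple (?c (Suc i)) (?c j) x = triple (?c i) (?c (Suc j)) x"
      using shift[of i j x] IH by simp
    then show ?case using Suc by simp
  qed
  define D where "D w = triple z z (triple (?c (Suc N)) z w) - triple (?c (Suc N)) z (triple z z w)" for w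
  have "D w = 0" for w
  proof -
    have desc: "triple (?c (N + 2 - j)) (?c j) w = triple (?c (N + 2)) z w - real j *\<^sub>R D w"
      if "j \<le> N + 2" for j
      using that
    proof (induction j)
      case (Suc j)
      define k where "k = N + 2 - Suc j"
      have k: "N + 2 - j = Suc k" "Suc N - j = k" "k + j = Suc N" using Suc.prems by (auto simp: k_def)
      have "triple (?c (Suc k)) (?c j) w - triple (?c k) (?c (Suc j)) w = D w"
        using shift[of k j w] eq[OF k(3)] by (simp add: D_def)
      then show ?case
        using Suc k(1,2) by (simp add: scaleR_left_distrib algebra_simps)
    qed simp
    have "- D w = triple (triple (?c (Suc N)) z z) z w - triple z (triple z (?c (Suc N)) z) w"
      using box_commutator[of "?c (Suc N)" z z z w] by (simp add: D_def)
    also have "triple (?c (Suc N)) z z = ?c (N + 2)"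
      by (simp add: odd_power_Suc triple_commute[of z z])
    also have "triple z (?c (Suc N)) z = ?c (N + 2)"
      using eq[of 0 "Suc N" z] by (simp add: odd_power_Suc triple_commute[of z z])
    also have "triple (?c (N + 2)) z w - triple z (?c (N + 2)) w = real (N + 2) *\<^sub>R D w"
      using desc[of "N + 2"] by simp
    finally have "- D w = real (N + 2) *\<^sub>R D w" .
    moreover have "real (N + 3) *\<^sub>R D w = real (N + 2) *\<^sub>R D w + D w"
      using scaleR_left_distrib[of "real (N + 2)" 1 "D w"] by (simp add: add_ac)
    ultimately have "real (N + 3) *\<^sub>R D w = 0" by (metis add.left_inverse)
    then show ?thesis by simp
  qed
  then show ?case using eq by (auto simp: D_def)
qed

lemma odd_power_box:
  "triple (odd_power z i) (odd_power z j) x = triple (odd_power z (i + j)) z x"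
  using odd_power_induction[of "i + j" z] by blast

lemma odd_power_box_0: "triple z (odd_power z j) x = triple (odd_power z j) z x"
  using odd_power_box[of z 0 j x] by simp

lemma odd_power_box_commute_0:
  "triple z z (triple (odd_power z n) z x) = triple (odd_power z n) z (triple z z x)"
  using odd_power_induction[of n z] by blast

lemma triple_odd_power:
  "triple (odd_power z i) (odd_power z j) (odd_power z k) = odd_power z (i + j + k + 1)"
proof -
  have "triple (odd_power z n) z (odd_power z k) = odd_power z (n + k + 1)" for n
  proof (induction k)
    case 0
    then show ?case by (simp add: odd_power_Suc triple_commute[of _ z z])
  next
    case (Suc k)
    then show ?case
      by (simp add: odd_power_Suc[of z k] odd_power_box_commute_0[symmetric])
        (simp add: odd_power_Suc)
  qed
  then show ?thesis by (simp add: odd_power_box[of z i j])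
qed

lemma odd_power_box_commute:
  "triple (odd_power z m) z (triple (odd_power z n) z x)
    = triple (odd_power z n) z (triple (odd_power z m) z x)"
proof -
  have "triple (odd_power z m) z (odd_power z n) = odd_power z (m + n + 1)"
    and "triple z (odd_power z m) z = odd_power z (m + 1)"
    using triple_odd_power[of z m 0 n] triple_odd_power[of z 0 m 0] by simp_all
  then have "triple (odd_power z m) z (triple (odd_power z n) z x)
      - triple (odd_power z n) z (triple (odd_power z m) z x) = 0"
    using box_commutator[of "odd_power z m" z "odd_power z n" z x]
      odd_power_box[of z n "m + 1" x] by (simp add: add_ac)
  then show ?thesis by simp
qed

lemma norm_odd_power_cube: "norm (odd_power z (Suc (3 * n))) = norm (odd_power z n) ^ 3"
proof -
  have "Suc (3 * n) = n + n + n + 1" by simp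
  then show ?thesis by (simp only: triple_odd_power[symmetric] norm_cube)
qed

text \<open>Exponents \<open>3\<^sup>k\<close> are reached by cubing, where the norm is multiplicative. Expanding a general
  exponent in powers of 3 costs a factor that is polynomial in the exponent, and cubing the element
  itself makes this factor negligible.\<close>

lemma norm_odd_power_le_1:
  assumes z: "norm z \<le> 1"
  shows "norm (odd_power z n) \<le> 1"
proof -
  \<comment> \<open>The index with \<open>2 e\<^sub>i + 1 = 3\<^sup>i\<close>.\<close>
  define e where "e = rec_nat (0::nat) (\<lambda>_ k. 3 * k + 1)"
  have e0: "e 0 = 0" and eS: "e (Suc i) = 3 * e i + 1" for i by (simp_all add: e_def)
  define M where "M = triple_const"
  have M: "1 \<le> M" by (simp add: M_def triple_const_ge_1)
  have e_le: "norm (odd_power z (e i)) \<le> 1" for i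
    by (induction i) (use z in \<open>auto simp: e0 eS norm_odd_power_cube power_le_one\<close>)
  have crude: "norm (odd_power z n) \<le> M ^ i" if "n \<le> e i" for i n
    using that
  proof (induction i arbitrary: n)
    case 0
    then show ?case using z by (simp add: e0)
  next
    case (Suc i)
    consider "n \<le> e i" | "e i < n" "n \<le> 2 * e i + 1" | "2 * e i + 1 < n" by linarith
    then show ?case
    proof cases
      case 1
      then have "norm (odd_power z n) \<le> M ^ i" by (rule Suc.IH)
      also have "\<dots> \<le> M ^ Suc i" using M by (intro power_increasing) auto
      finally show ?thesis .
    next
      case 2
      define r where "r = n - e i - 1"
      have r: "n = e i + 0 + r + 1" "r \<le> e i" using 2 by (auto simp: r_def)
      have "norm (triple (odd_power z (e i)) (odd_power z 0) (odd_power z r)) \<le> M * 1 * 1 * M ^ i"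
        unfolding M_def by (rule norm_triple_le') (use e_le z Suc.IH[OF r(2)] in \<open>auto simp: M_def\<close>)
      then show ?thesis by (simp only: triple_odd_power r(1)[symmetric]) simp
    next
      case 3
      define r where "r = n - 2 * e i - 1"
      have r: "n = e i + e i + r + 1" "r \<le> e i" using 3 Suc.prems by (auto simp: r_def eS)
      have "norm (triple (odd_power z (e i)) (odd_power z (e i)) (odd_power z r)) \<le> M * 1 * 1 * M ^ i"
        unfolding M_def by (rule norm_triple_le') (use e_le Suc.IH[OF r(2)] in \<open>auto simp: M_def\<close>)
      then show ?thesis by (simp only: triple_odd_power r(1)[symmetric]) simp
    qed
  qed
  define r where "r = norm (odd_power z n)"
  have n_le: "n \<le> e n" by (induction n) (auto simp: eS)
  have tower: "\<exists>m \<le> e (n + j). norm (odd_power z m) = r ^ (3 ^ j)" for j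
  proof (induction j)
    case 0
    then show ?case using n_le by (auto simp: r_def)
  next
    case (Suc j)
    then obtain m where m: "m \<le> e (n + j)" "norm (odd_power z m) = r ^ (3 ^ j)" by blast
    have "norm (odd_power z (Suc (3 * m))) = r ^ (3 ^ Suc j)"
      unfolding norm_odd_power_cube m(2) by (simp add: power_mult[symmetric] mult.commute)
    moreover have "Suc (3 * m) \<le> e (n + Suc j)" using m by (simp add: eS)
    ultimately show ?case by blast
  qed
  have bound: "r ^ (3 ^ j) \<le> M ^ (n + j)" for j
    using tower[of j] crude by metis
  show ?thesis
  proof (rule ccontr)
    assume "\<not> norm (odd_power z n) \<le> 1"
    then have r: "1 < r" by (simp add: r_def)
    define c where "c = (real n + 1) * ln M / ln r"
    obtain j where j: "c < (3 / 2) ^ j" using real_arch_pow[of "3 / 2" c] by auto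
    have "ln (r ^ (3 ^ j)) \<le> ln (M ^ (n + j))"
      using bound[of j] r M by (subst ln_le_cancel_iff) auto
    then have "3 ^ j * ln r \<le> real (n + j) * ln M"
      using r M by (simp add: ln_realpow)
    also have "\<dots> \<le> ((real n + 1) * 2 ^ j) * ln M"
    proof (rule mult_right_mono)
      have "real j \<le> 2 ^ j" "1 \<le> (2::real) ^ j"
        using of_nat_less_two_power[of j, where 'a = real] by simp_all
      moreover have "real n * 1 \<le> real n * 2 ^ j" by (intro mult_left_mono) auto
      ultimately show "real (n + j) \<le> (real n + 1) * 2 ^ j"
        unfolding distrib_right of_nat_add by linarith
    qed (use M in simp)
    finally have "3 ^ j * ln r \<le> ((real n + 1) * ln M) * 2 ^ j" by (simp add: mult_ac)
    then have "(3 / 2) ^ j \<le> c"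
      using r by (simp add: c_def power_divide field_simps)
    with j show False by simp
  qed
qed

lemma norm_odd_power_ge:
  assumes z: "norm z = 1"
  shows "1 \<le> triple_const * norm (odd_power z k)"
proof -
  \<comment> \<open>The index with \<open>2 e\<^sub>i + 1 = 3\<^sup>i\<close>.\<close>
  define e where "e = rec_nat (0::nat) (\<lambda>_ k. 3 * k + 1)"
  have e0: "e 0 = 0" and eS: "e (Suc i) = 3 * e i + 1" for i by (simp_all add: e_def)
  have e1: "norm (odd_power z (e i)) = 1" for i
    by (induction i) (use z in \<open>auto simp: e0 eS norm_odd_power_cube\<close>)
  have "i \<le> e i" for i by (induction i) (auto simp: eS)
  from this[of "Suc k"] obtain r where r: "e (Suc k) = k + 0 + r + 1"
    by (metis Suc_eq_plus1 add.commute add_0_right add_Suc_right le_Suc_ex)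
  have "1 = norm (triple (odd_power z k) (odd_power z 0) (odd_power z r))"
    using e1[of "Suc k"] by (simp only: triple_odd_power r)
  also have "\<dots> \<le> triple_const * norm (odd_power z k) * 1 * 1"
    by (rule norm_triple_le') (use z norm_odd_power_le_1[of z r] in auto)
  finally show ?thesis by simp
qed

end

context jb_star_triple
begin

section \<open>Boundedness of the powers of box operators\<close>

text \<open>Let \<open>C\<^sub>0 = id\<close>, \<open>C\<^sub>n\<^sub>+\<^sub>1 = L(z\<^sub>n, z)\<close> and \<open>S = Q(z)\<^sup>2\<close>. In a Peirce decomposition with respect
  to a finite sum of orthogonal tripotents, \<open>C\<^sub>n\<close> acts as \<open>(\<lambda>\<^sup>2\<^sup>n + \<mu>\<^sup>2\<^sup>n) / 2\<close> and \<open>S\<close> as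
  \<open>\<lambda>\<^sup>2 \<mu>\<^sup>2\<close>; the identities below are the addition theorem for these functions.\<close>

definition box_power :: "'a \<Rightarrow> nat \<Rightarrow> 'a \<Rightarrow> 'a" where
  "box_power z n x = (case n of 0 \<Rightarrow> x | Suc m \<Rightarrow> triple (odd_power z m) z x)"

definition quad_sq :: "'a \<Rightarrow> 'a \<Rightarrow> 'a" where
  "quad_sq z x = triple z (triple z x z) z"

lemma box_power_0 [simp]: "box_power z 0 x = x"
  and box_power_Suc: "box_power z (Suc n) x = triple (odd_power z n) z x"
  by (simp_all add: box_power_def)

lemma box_power_commute: "box_power z m (box_power z n x) = box_power z n (box_power z m x)"
  by (cases m; cases n) (simp_all add: box_power_Suc odd_power_box_commute)

lemma quad_box_power: "triple z (box_power z n x) z = box_power z n (triple z x z)"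
proof (cases n)
  case (Suc m)
  have "triple (odd_power z m) z (triple z x z) = triple z (odd_power z m) (triple z x z)"
    by (rule odd_power_box_0[symmetric])
  also have "\<dots> = triple z (triple (odd_power z m) z x) z" by (rule box_quadratic)
  finally show ?thesis by (simp add: Suc box_power_Suc)
qed simp

lemma quad_sq_box_power: "quad_sq z (box_power z n x) = box_power z n (quad_sq z x)"
  by (simp add: quad_sq_def quad_box_power)

lemma box_power_add: "box_power z n (x + y) = box_power z n x + box_power z n y"
  by (cases n) (simp_all add: box_power_Suc triple_linear)

lemma quad_sq_add: "quad_sq z (x + y) = quad_sq z x + quad_sq z y"
  by (simp add: quad_sq_def triple_linear)

lemma box_power_recurrence:
  "2 *\<^sub>R box_power z 1 (box_power z (Suc n) x) = box_power z (Suc (Suc n)) x + quad_sq z (box_power z n x)"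
proof -
  let ?c = "odd_power z"
  have outer: "triple (?c n) (triple z x z) z = quad_sq z (box_power z n x)"
  proof (cases n)
    case 0
    then show ?thesis by (simp add: quad_sq_def)
  next
    case (Suc m)
    define w where "w = triple z x z"
    have c: "triple z (?c m) z = ?c n" using triple_odd_power[of z 0 m 0] by (simp add: Suc)
    have e1: "triple (triple z w z) (?c m) z = triple z (triple (?c m) z w) z"
      using box_quadratic[of z "?c m" w] by (simp add: triple_commute[of "triple z w z"])
    have e2: "triple z (?c m) (triple z w z) = triple z (triple (?c m) z w) z"
      by (rule box_quadratic)
    have e3: "triple z (triple w z (?c m)) z = triple z (triple (?c m) z w) z"
      by (simp add: triple_commute[of w])
    have "triple (?c n) w z = triple z w (triple z (?c m) z)"
      by (simp add: c triple_commute[of z w])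
    also have "\<dots> = triple z (triple (?c m) z w) z"
      unfolding jordan_identity[of z w z "?c m" z] e1 e2 e3 by simp
    also have "\<dots> = quad_sq z (box_power z n x)"
      unfolding w_def Suc box_power_Suc[symmetric] quad_box_power[symmetric] quad_sq_def ..
    finally show ?thesis by (simp add: w_def)
  qed
  have "box_power z (Suc (Suc n)) x = triple x z (triple (?c n) z z)"
    unfolding box_power_Suc odd_power_Suc triple_commute[of "?c n" z z]
    by (rule triple_commute)
  also have "\<dots> = triple (triple x z (?c n)) z z - triple (?c n) (triple z x z) z
      + triple (?c n) z (triple x z z)"
    by (rule jordan_identity)
  also have "\<dots> = box_power z 1 (box_power z (Suc n) x) - quad_sq z (box_power z n x)
      + box_power z (Suc n) (box_power z 1 x)"
    unfolding outer box_power_Suc odd_power_0 One_nat_def triple_commute[of x z "?c n"]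
      triple_commute[of x z z] triple_commute[of "triple (?c n) z x" z z] ..
  finally show ?thesis using box_power_commute[of z "Suc n" 1 x] by (simp add: scaleR_2)
qed

lemma box_power_product:
  "m \<le> n \<Longrightarrow> 2 *\<^sub>R box_power z m (box_power z n x)
    = box_power z (n + m) x + (quad_sq z ^^ m) (box_power z (n - m) x)"
proof (induction m arbitrary: n x rule: less_induct)
  case (less m)
  consider "m = 0" | "m = 1" | k where "m = Suc (Suc k)"
    by (metis One_nat_def not0_implies_Suc)
  then show ?case
  proof cases
    case 1
    then show ?thesis by (simp add: scaleR_2)
  next
    case 2
    then obtain l where "n = Suc l" using less.prems by (cases n) auto
    then show ?thesis using box_power_recurrence[of z l x] 2 by simp
  next
    case 3
    define l where "l = n - m"
    have l: "n - Suc k = Suc l" "n = Suc k + Suc l" "n - k = Suc (Suc l)"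
      using 3 less.prems by (simp_all add: l_def)
    let ?C = "box_power z" and ?S = "quad_sq z"
    define y where "y = ?C n x"
    have C2: "?C r (2 *\<^sub>R u) = 2 *\<^sub>R ?C r u" for r u by (simp add: scaleR_2 box_power_add)
    have S2: "?S (2 *\<^sub>R u) = 2 *\<^sub>R ?S u" for u by (simp add: scaleR_2 quad_sq_add)
    have CS: "?C r ((?S ^^ j) u) = (?S ^^ j) (?C r u)" for r j u
      by (induction j) (simp_all add: quad_sq_box_power[symmetric])
    have Sadd: "(?S ^^ j) (u + v) = (?S ^^ j) u + (?S ^^ j) v" for j u v
      by (rule funpow_additive) (rule quad_sq_add)
    have one: "2 *\<^sub>R ?C 1 (?C (Suc r) u) = ?C (Suc (Suc r)) u + ?S (?C r u)" for r u
      by (rule box_power_recurrence)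
    have ih1: "2 *\<^sub>R ?C (Suc k) y = ?C (n + Suc k) x + (?S ^^ Suc k) (?C (Suc l) x)"
      using less.IH[of "Suc k" n x] 3 less.prems l by (simp add: y_def)
    have ih0: "2 *\<^sub>R ?C k y = ?C (n + k) x + (?S ^^ k) (?C (Suc (Suc l)) x)"
      using less.IH[of k n x] 3 less.prems l by (simp add: y_def)
    have "2 *\<^sub>R ?C m y = 2 *\<^sub>R (2 *\<^sub>R ?C 1 (?C (Suc k) y) - ?S (?C k y))"
      using one[of k y] 3 by simp
    also have "\<dots> = 2 *\<^sub>R ?C 1 (2 *\<^sub>R ?C (Suc k) y) - ?S (2 *\<^sub>R ?C k y)"
      by (simp add: C2 S2 scaleR_right_diff_distrib)
    also have "2 *\<^sub>R ?C 1 (2 *\<^sub>R ?C (Suc k) y)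
        = 2 *\<^sub>R ?C 1 (?C (Suc (n + k)) x) + (?S ^^ Suc k) (2 *\<^sub>R ?C 1 (?C (Suc l) x))"
      unfolding ih1
      by (simp add: box_power_add CS scaleR_right_distrib scaleR_2 Sadd quad_sq_add
          quad_sq_box_power del: funpow.simps)
    also have "\<dots> = (?C (n + m) x + ?S (?C (n + k) x))
        + (?S ^^ Suc k) (?C (Suc (Suc l)) x + ?S (?C l x))"
      unfolding one using 3 by simp
    also have "?S (2 *\<^sub>R ?C k y) = ?S (?C (n + k) x) + (?S ^^ Suc k) (?C (Suc (Suc l)) x)"
      unfolding ih0 by (simp add: quad_sq_add)
    finally have "2 *\<^sub>R ?C m y = ?C (n + m) x + (?S ^^ Suc k) (?S (?C l x))"
      by (simp only: Sadd) simp
    moreover have "(?S ^^ Suc k) (?S u) = (?S ^^ m) u" for u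
      using 3 by (simp add: funpow_swap1)
    ultimately show ?thesis by (simp add: y_def l_def)
  qed
qed

text \<open>The sequence \<open>C\<^sub>n\<close> is bounded for \<open>\<parallel>z\<parallel> \<le> 1\<close>, hence so is \<open>S\<^sup>n = 2 C\<^sub>n\<^sup>2 - C\<^sub>2\<^sub>n\<close>; and the
  powers of \<open>C\<^sub>1\<close> are convex combinations of the \<open>S\<^sup>k C\<^sub>n\<close>.\<close>

lemma box_power_bounded:
  assumes z: "norm z \<le> 1"
  obtains B where "1 \<le> B" "\<And>j x. norm ((triple z z ^^ j) x) \<le> B * norm x"
proof -
  define M where "M = triple_const"
  have M: "1 \<le> M" by (simp add: M_def triple_const_ge_1)
  let ?C = "box_power z" and ?S = "quad_sq z"
  have C: "norm (?C n x) \<le> M * norm x" for n x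
  proof (cases n)
    case 0
    then show ?thesis using M mult_right_mono[OF M norm_ge_zero[of x]] by simp
  next
    case (Suc m)
    have "norm (triple (odd_power z m) z x) \<le> triple_const * 1 * 1 * norm x"
      by (rule norm_triple_le') (use z norm_odd_power_le_1[OF z] in auto)
    then show ?thesis by (simp add: Suc box_power_Suc M_def)
  qed
  have S: "norm ((?S ^^ k) x) \<le> (2 * M * M + M) * norm x" for k x
  proof -
    have "(?S ^^ k) x = 2 *\<^sub>R ?C k (?C k x) - ?C (k + k) x"
      using box_power_product[of k k z x] by simp
    then have "norm ((?S ^^ k) x) \<le> 2 * norm (?C k (?C k x)) + norm (?C (k + k) x)"
      using norm_triangle_ineq4[of "2 *\<^sub>R ?C k (?C k x)" "?C (k + k) x"] by simp
    also have "\<dots> \<le> 2 * (M * (M * norm x)) + M * norm x"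
      using order_trans[OF C[of k "?C k x"] mult_left_mono[OF C[of k x]]] C[of "k + k" x] M
      by (intro add_mono mult_left_mono) auto
    finally show ?thesis by (simp add: algebra_simps)
  qed
  define B where "B = (2 * M * M + M) * M"
  have SC: "norm ((?S ^^ k) (?C n x)) \<le> B * norm x" for k n x
  proof -
    have "norm ((?S ^^ k) (?C n x)) \<le> (2 * M * M + M) * norm (?C n x)" by (rule S)
    also have "\<dots> \<le> (2 * M * M + M) * (M * norm x)" using C M by (intro mult_left_mono) auto
    finally show ?thesis by (simp add: B_def)
  qed
  have C1: "?C 1 = triple z z" by (rule ext) (simp add: box_power_Suc)
  have CS: "?C r ((?S ^^ j) u) = (?S ^^ j) (?C r u)" for r j u
    by (induction j) (simp_all add: quad_sq_box_power[symmetric])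
  have Sadd: "(?S ^^ j) (u + v) = (?S ^^ j) u + (?S ^^ j) v" for j u v
    by (rule funpow_additive) (rule quad_sq_add)
  have Cadd: "(?C 1 ^^ j) (u + v) = (?C 1 ^^ j) u + (?C 1 ^^ j) v" for j u v
    by (rule funpow_additive) (rule box_power_add)
  have all: "norm ((?C 1 ^^ j) ((?S ^^ k) (?C n x))) \<le> B * norm x" for j k n x
  proof (induction j arbitrary: k n)
    case 0
    then show ?case using SC by simp
  next
    case (Suc j)
    show ?case
    proof (cases n)
      case 0
      have "(?C 1 ^^ Suc j) ((?S ^^ k) (?C n x)) = (?C 1 ^^ j) ((?S ^^ k) (?C 1 x))"
        by (simp only: funpow_Suc_right o_apply CS 0 box_power_0)
      then show ?thesis using Suc by simp
    next
      case (Suc l)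
      have "2 *\<^sub>R (?C 1 ^^ Suc j) ((?S ^^ k) (?C n x))
          = (?C 1 ^^ j) ((?S ^^ k) (2 *\<^sub>R ?C 1 (?C (Suc l) x)))"
        by (simp only: funpow_Suc_right o_apply CS scaleR_2 Sadd Cadd Suc)
      also have "\<dots> = (?C 1 ^^ j) ((?S ^^ k) (?C (Suc (Suc l)) x)) + (?C 1 ^^ j) ((?S ^^ Suc k) (?C l x))"
        by (simp only: box_power_recurrence Sadd Cadd funpow_Suc_right o_apply)
      finally have "2 * norm ((?C 1 ^^ Suc j) ((?S ^^ k) (?C n x)))
          = norm ((?C 1 ^^ j) ((?S ^^ k) (?C (Suc (Suc l)) x)) + (?C 1 ^^ j) ((?S ^^ Suc k) (?C l x)))"
        by (metis abs_numeral norm_scaleR)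
      also have "\<dots> \<le> B * norm x + B * norm x"
        by (rule norm_triangle_le[OF add_mono[OF Suc.IH Suc.IH]])
      finally show ?thesis by simp
    qed
  qed
  have "1 * 1 \<le> (2 * M * M + M) * M"
    using M by (intro mult_mono) (auto intro: add_increasing)
  then have "1 \<le> B" by (simp add: B_def)
  moreover have "norm ((triple z z ^^ j) x) \<le> B * norm x" for j x
    using all[of j 0 0 x] unfolding C1 by simp
  ultimately show thesis by (rule that)
qed

section \<open>The numerical range of box operators\<close>

lemma box_real: "supports \<phi> x \<Longrightarrow> Im (\<phi> (triple a a x)) = 0"
  by (rule hermitian_operator_real[OF hermitian])

lemma box_nonneg: "supports \<phi> x \<Longrightarrow> 0 \<le> Re (\<phi> (triple a a x))"
  by (rule nonneg_numerical_range[OF bounded_clinear_triple _ nonneg_spectrum]) (rule box_real)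

text \<open>The Neumann series converges although \<open>L(y, y)\<close> is not yet known to be a contraction, because
  its powers are bounded.\<close>

lemma box_invertible_above:
  assumes y: "norm y = 1" and l: "1 < l"
  shows "\<exists>B. bounded_clinear scaleC B \<and> (\<forall>x. B (l *\<^sub>R x - triple y y x) = x)
      \<and> (\<forall>x. l *\<^sub>R B x - triple y y (B x) = x)"
proof -
  let ?A = "triple y y"
  obtain K where K: "1 \<le> K" "\<And>j x. norm ((?A ^^ j) x) \<le> K * norm x"
    using box_power_bounded[of y] y by auto
  define q where "q = inverse l"
  have q: "0 < q" "q < 1" "q * l = 1" using l by (simp_all add: q_def inverse_less_1_iff)
  have A: "bounded_linear ?A" using bounded_clinear_triple[of y y] by (simp add: bounded_clinear_def)
  define f where "f = (\<lambda>x n. q ^ Suc n *\<^sub>R (?A ^^ n) x)"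
  have nf: "norm (f x n) \<le> q ^ n * (q * K * norm x)" for x n
  proof -
    have "q ^ Suc n * norm ((?A ^^ n) x) \<le> q ^ Suc n * (K * norm x)"
      using q K(2) by (intro mult_left_mono) auto
    then show ?thesis using q by (simp add: f_def mult_ac)
  qed
  have sg: "summable (\<lambda>n. q ^ n * (q * K * norm x))" for x
    using q by (intro summable_mult2 summable_geometric) simp
  have snf: "summable (\<lambda>n. norm (f x n))" for x
    by (rule summable_comparison_test'[OF sg, where N = 0]) (use nf in simp)
  have sf: "summable (f x)" for x by (rule summable_norm_cancel[OF snf])
  define B where "B x = (\<Sum>n. f x n)" for x
  have Badd: "B (x + y) = B x + B y" for x y
    unfolding B_def suminf_add[OF sf sf]
    by (simp add: f_def linear_simps(1)[OF bounded_linear_funpow[OF A]] scaleR_right_distrib)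
  have powC: "(?A ^^ n) (c *\<^sub>C x) = c *\<^sub>C (?A ^^ n) x" for n c x
    by (induction n) (simp_all add: triple_scale_right)
  have BC: "B (c *\<^sub>C x) = c *\<^sub>C B x" for c x
    unfolding B_def bounded_linear.suminf[OF bounded_linear_scaleC sf]
    by (simp add: f_def powC scaleR_eq_scaleC mult.commute)
  have BA: "B (?A x) = ?A (B x)" for x
    unfolding B_def bounded_linear.suminf[OF A sf]
    by (simp add: f_def triple_scaleR funpow_swap1)
  have BR: "B (r *\<^sub>R x) = r *\<^sub>R B x" for r x by (simp add: scaleR_eq_scaleC BC)
  have inv: "l *\<^sub>R B x - ?A (B x) = x" for x
  proof -
    have "l *\<^sub>R B x = (\<Sum>n. l *\<^sub>R f x n)"
      unfolding B_def by (rule suminf_scaleR_right[OF sf])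
    also have "\<dots> = (\<Sum>n. q ^ n *\<^sub>R (?A ^^ n) x)"
      using q(3) by (simp add: f_def mult.assoc[symmetric] mult.commute)
    also have "\<dots> = (\<Sum>n. ?A (f x n)) + x"
    proof -
      have eq: "q ^ Suc n *\<^sub>R (?A ^^ Suc n) x = ?A (f x n)" for n
        by (simp add: f_def triple_scaleR)
      have "summable (\<lambda>n. q ^ Suc n *\<^sub>R (?A ^^ Suc n) x)"
        unfolding eq by (rule bounded_linear.summable[OF A sf])
      then have "summable (\<lambda>n. q ^ n *\<^sub>R (?A ^^ n) x)" by (subst (asm) summable_Suc_iff)
      from suminf_split_head[OF this] show ?thesis unfolding eq by simp
    qed
    also have "(\<Sum>n. ?A (f x n)) = ?A (B x)"
      unfolding B_def by (rule bounded_linear.suminf[OF A sf, symmetric])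
    finally show ?thesis by simp
  qed
  have "norm (B x) \<le> (\<Sum>n. q ^ n * (q * K)) * norm x" for x
  proof -
    have "norm (B x) \<le> (\<Sum>n. norm (f x n))" unfolding B_def by (rule summable_norm[OF snf])
    also have "\<dots> \<le> (\<Sum>n. q ^ n * (q * K * norm x))" by (rule suminf_le[OF nf snf sg])
    also have "\<dots> = (\<Sum>n. q ^ n * (q * K)) * norm x"
    proof -
      have "summable (\<lambda>n. q ^ n * (q * K))"
        using q by (intro summable_mult2 summable_geometric) simp
      from suminf_mult2[OF this, of "norm x"] show ?thesis by (simp only: mult.assoc)
    qed
    finally show ?thesis .
  qed
  then have "bounded_clinear scaleC B" using Badd BC by (intro bounded_clinearI)
  moreover have "B (l *\<^sub>R x - ?A x) = x" for x
  proof -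
    have "B (l *\<^sub>R x + (-1) *\<^sub>R ?A x) = l *\<^sub>R B x + (-1) *\<^sub>R ?A (B x)"
      by (simp only: Badd BR BA)
    then show ?thesis using inv[of x] by simp
  qed
  ultimately show ?thesis using inv by blast
qed

end

context jb_star_triple
begin

text \<open>After normalising \<open>y\<close>, the operator \<open>1 - L(y, y)\<close> has real numerical range and, by the Neumann
  series, non-negative spectrum.\<close>

lemma box_le:
  assumes \<phi>: "supports \<phi> x"
  shows "Re (\<phi> (triple y y x)) \<le> (norm y)\<^sup>2 * norm x"
proof (cases "y = 0")
  case True
  then show ?thesis by (simp add: triple_zero supports_zero[OF \<phi>])
next
  case False
  define z where "z = inverse (norm y) *\<^sub>R y"
  have z: "norm z = 1" using False by (simp add: z_def)
  have y: "triple y y x = (norm y)\<^sup>2 *\<^sub>R triple z z x" for x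
  proof -
    have "y = norm y *\<^sub>R z" using False by (simp add: z_def)
    then have "triple y y x = triple (norm y *\<^sub>R z) (norm y *\<^sub>R z) x" by simp
    then show ?thesis by (simp only: triple_scaleR scaleR_scaleR power2_eq_square)
  qed
  define K where "K x = x - triple z z x" for x
  have bK: "bounded_clinear scaleC K"
  proof (rule bounded_clinearI)
    show "K (u + v) = K u + K v" for u v by (simp add: K_def triple_linear)
    show "K (c *\<^sub>C u) = c *\<^sub>C K u" for c u
      by (simp add: K_def triple_scale_right scale_right_diff_distrib)
    show "norm (K u) \<le> (1 + triple_const) * norm u" for u
      using norm_triangle_ineq4[of u "triple z z u"] norm_triple_le[of z z u] z
      by (simp add: K_def distrib_right)
  qed
  have real: "Im (\<psi> (K u)) = 0" if "supports \<psi> u" for \<psi> u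
    using box_real[OF that] by (simp add: K_def supports_diff[OF that] supports_self[OF that])
  have spec: "operator_spectrum scaleC K \<subseteq> \<real>\<^sub>\<ge>\<^sub>0"
  proof
    fix \<mu> assume \<mu>: "\<mu> \<in> operator_spectrum scaleC K"
    show "\<mu> \<in> \<real>\<^sub>\<ge>\<^sub>0"
    proof (rule ccontr)
      assume neg: "\<mu> \<notin> \<real>\<^sub>\<ge>\<^sub>0"
      define \<nu> where "\<nu> = 1 - \<mu>"
      have K\<mu>: "K u - \<mu> *\<^sub>C u = \<nu> *\<^sub>C u - triple z z u" for u
        by (simp add: K_def \<nu>_def scale_left_diff_distrib)
      have "\<exists>B. bounded_clinear scaleC B \<and> (\<forall>u. B (\<nu> *\<^sub>C u - triple z z u) = u)
          \<and> (\<forall>u. \<nu> *\<^sub>C B u - triple z z (B u) = u)"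
      proof (cases "\<nu> \<in> \<real>\<^sub>\<ge>\<^sub>0")
        case True
        then have im: "Im \<nu> = 0" and "0 \<le> Re \<nu>" by (auto simp: complex_nonneg_Reals_iff)
        moreover have "Im \<mu> = 0" using im by (simp add: \<nu>_def)
        ultimately have "1 < Re \<nu>" using neg by (auto simp: \<nu>_def complex_nonneg_Reals_iff)
        moreover have "\<nu> = of_real (Re \<nu>)" using im by (simp add: complex_eq_iff)
        ultimately show ?thesis
          using box_invertible_above[OF z, of "Re \<nu>"] by (metis scaleR_eq_scaleC)
      next
        case False
        then have "\<nu> \<notin> operator_spectrum scaleC (triple z z)" using nonneg_spectrum by blast
        then obtain B where B: "bounded_clinear scaleC B"
          "\<And>u. B (triple z z u - \<nu> *\<^sub>C u) = u" "\<And>u. triple z z (B u) - \<nu> *\<^sub>C B u = u"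
          by (auto simp: operator_spectrum_def)
        note D = bounded_clinearD[OF B(1)]
        obtain c where c: "\<And>u. norm (B u) \<le> c * norm u" using D(7) by blast
        have "bounded_clinear scaleC (\<lambda>u. - B u)"
          by (rule bounded_clinearI[where K = c]) (simp_all add: D c)
        moreover have "- B (\<nu> *\<^sub>C u - triple z z u) = u" for u
          using B(2)[of u] D(6)[of "triple z z u - \<nu> *\<^sub>C u"] by simp
        moreover have "\<nu> *\<^sub>C (- B u) - triple z z (- B u) = u" for u
          using B(3)[of u] triple_scaleR(3)[of z z "-1" "B u"] by simp
        ultimately show ?thesis by (intro exI[of _ "\<lambda>u. - B u"]) auto
      qed
      then have "\<mu> \<notin> operator_spectrum scaleC K"
        unfolding operator_spectrum_def K\<mu>[symmetric] by blast
      with \<mu> show False by blast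
    qed
  qed
  have "0 \<le> Re (\<phi> (K x))"
    by (rule nonneg_numerical_range[OF bK _ spec \<phi>]) (rule real)
  then have "Re (\<phi> (triple z z x)) \<le> norm x"
    by (simp add: K_def supports_diff[OF \<phi>] supports_self[OF \<phi>])
  then have "(norm y)\<^sup>2 * Re (\<phi> (triple z z x)) \<le> (norm y)\<^sup>2 * norm x"
    by (rule mult_left_mono) simp
  then show ?thesis by (simp add: y supports_scaleR[OF \<phi>])
qed

text \<open>Conversely the numerical range of \<open>L(w, w)\<close> reaches \<open>\<parallel>w\<parallel>\<^sup>2\<close>: if it stayed below
  \<open>\<rho> < 1 = \<parallel>w\<parallel>\<close>, the polynomial \<open>(1 + h \<zeta> L(w, w))\<^sup>N w\<close> would be too small on the unit circle for its
  coefficients, which are binomial multiples of odd powers of \<open>w\<close>.\<close>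

lemma numerical_range_reaches_norm:
  assumes w: "norm w = 1" and \<rho>: "0 \<le> \<rho>"
    and le: "\<And>\<phi> x. supports \<phi> x \<Longrightarrow> Re (\<phi> (triple w w x)) \<le> \<rho> * norm x"
  shows "1 \<le> \<rho>"
proof (rule ccontr)
  assume "\<not> 1 \<le> \<rho>"
  then have \<rho>1: "\<rho> < 1" by simp
  define M where "M = triple_const"
  have M: "1 \<le> M" by (simp add: M_def triple_const_ge_1)
  let ?A = "triple w w"
  have A: "norm (?A x) \<le> M * norm x" for x using norm_triple_le[of w w x] w by (simp add: M_def)
  have mod: "cmod (\<phi> (?A x)) \<le> \<rho> * norm x" if "supports \<phi> x" for \<phi> x
    using le[OF that] box_nonneg[OF that, of w] box_real[OF that, of w]
    by (simp add: cmod_eq_Re)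
  define P where "P = M\<^sup>2 + \<rho>"
  \<comment> \<open>The step \<open>h\<close> is so small that the growth factor \<open>g\<close> below is less than \<open>1 + h\<close>.\<close>
  define h where "h = (1 - \<rho>) / (2 * P)"
  have "1 \<le> M\<^sup>2" using M by simp
  then have pos: "0 < P" using \<rho> by (simp add: P_def)
  have h0: "0 < h" using \<rho>1 pos by (simp add: h_def)
  have "h * P < 1 - \<rho>" using \<rho>1 pos by (simp add: h_def)
  then have hM: "h * (M\<^sup>2 + \<rho>) < 1 - \<rho>" by (simp only: P_def)
  have "h * \<rho> \<le> h * (M\<^sup>2 + \<rho>)" using h0 by (intro mult_left_mono) auto
  with hM \<rho> have h\<rho>: "h * \<rho> < 1" by linarith
  define g where "g = (1 + h\<^sup>2 * M\<^sup>2) / (1 - h * \<rho>)"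
  have g0: "0 < g" using h\<rho> by (simp add: g_def add_pos_nonneg)
  have gh: "g < 1 + h"
  proof -
    have "h * (h * (M\<^sup>2 + \<rho>)) < h * (1 - \<rho>)" using hM h0 by simp
    then have "1 + h\<^sup>2 * M\<^sup>2 < (1 + h) * (1 - h * \<rho>)"
      by (simp add: power2_eq_square algebra_simps)
    then show ?thesis using h\<rho> by (simp add: g_def pos_divide_less_eq)
  qed
  have step: "norm (x + (h * \<zeta>) *\<^sub>C ?A x) \<le> g * norm x" if \<zeta>: "cmod \<zeta> = 1" for x and \<zeta> :: complex
  proof -
    define v where "v = x + (h * \<zeta>) *\<^sub>C ?A x"
    obtain \<phi> where \<phi>: "supports \<phi> v" using ex_supports by blast
    have v_eq: "v = x + (h * \<zeta>) *\<^sub>C ?A v - (h * \<zeta> * (h * \<zeta>)) *\<^sub>C ?A (?A x)"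
      by (simp add: v_def triple_add_right triple_scale_right scale_right_distrib)
    have "norm v = cmod (\<phi> v)" by (simp add: supports_self[OF \<phi>])
    also have "\<dots> = cmod (\<phi> (x + (h * \<zeta>) *\<^sub>C ?A v - (h * \<zeta> * (h * \<zeta>)) *\<^sub>C ?A (?A x)))"
      using arg_cong[OF v_eq, of "\<lambda>u. cmod (\<phi> u)"] .
    also have "\<dots> = cmod (\<phi> x + h * \<zeta> * \<phi> (?A v) - h * \<zeta> * (h * \<zeta>) * \<phi> (?A (?A x)))"
      by (simp add: supports_add[OF \<phi>] supports_diff[OF \<phi>] supports_scaleC[OF \<phi>])
    also have "\<dots> \<le> cmod (\<phi> x) + h * cmod (\<phi> (?A v)) + (h * h) * cmod (\<phi> (?A (?A x)))"
      using h0 \<zeta> norm_triangle_ineq4[of "\<phi> x + h * \<zeta> * \<phi> (?A v)" "h * \<zeta> * (h * \<zeta>) * \<phi> (?A (?A x))"]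
        norm_triangle_ineq[of "\<phi> x" "h * \<zeta> * \<phi> (?A v)"] by (simp add: norm_mult)
    also have "\<dots> \<le> norm x + h * (\<rho> * norm v) + (h * h) * (M * (M * norm x))"
    proof -
      have "cmod (\<phi> (?A (?A x))) \<le> M * (M * norm x)"
        using supports_bound[OF \<phi>, of "?A (?A x)"] A[of "?A x"]
          mult_left_mono[OF A[of x], of M] M by linarith
      then show ?thesis
        using h0 supports_bound[OF \<phi>, of x] mod[OF \<phi>]
        by (intro add_mono mult_left_mono) auto
    qed
    finally have "norm v * (1 - h * \<rho>) \<le> (1 + h\<^sup>2 * M\<^sup>2) * norm x"
      by (simp add: power2_eq_square algebra_simps)
    then show ?thesis using h\<rho> by (simp add: v_def g_def pos_le_divide_eq)
  qed
  let ?c = "odd_power w"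
  have poly: "((\<lambda>x. x + (h * \<zeta>) *\<^sub>C ?A x) ^^ N) w
      = (\<Sum>k\<le>N. (of_nat (N choose k) * (h * \<zeta>) ^ k) *\<^sub>C ?c k)" for \<zeta> :: complex and N
  proof (induction N)
    case (Suc N)
    let ?t = "\<lambda>N k. (of_nat (N choose k) * (h * \<zeta>) ^ k) *\<^sub>C ?c k"
    let ?u = "\<lambda>k. (of_nat (N choose k) * (h * \<zeta>) ^ Suc k) *\<^sub>C ?c (Suc k)"
    have Asum: "?A (sum f I) = (\<Sum>i\<in>I. ?A (f i))" for f :: "nat \<Rightarrow> 'a" and I
      by (induction I rule: infinite_finite_induct) (simp_all add: triple_linear)
    have "(\<Sum>k\<le>Suc N. ?t (Suc N) k) = ?t (Suc N) 0 + (\<Sum>k\<le>N. ?t (Suc N) (Suc k))"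
      by (rule sum.atMost_Suc_shift)
    also have "(\<Sum>k\<le>N. ?t (Suc N) (Suc k)) = (\<Sum>k\<le>N. ?u k) + (\<Sum>k\<le>N. ?t N (Suc k))"
      by (simp add: sum.distrib[symmetric] scale_left_distrib[symmetric] distrib_right
          del: power_Suc)
    also have "?t (Suc N) 0 + ((\<Sum>k\<le>N. ?u k) + (\<Sum>k\<le>N. ?t N (Suc k)))
        = (\<Sum>k\<le>N. ?u k) + (\<Sum>k\<le>Suc N. ?t N k)"
      unfolding sum.atMost_Suc_shift[of "?t N"] by simp
    also have "(\<Sum>k\<le>Suc N. ?t N k) = (\<Sum>k\<le>N. ?t N k)" by simp
    also have "(\<Sum>k\<le>N. ?u k) = (h * \<zeta>) *\<^sub>C ?A (\<Sum>k\<le>N. ?t N k)"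
      by (simp add: Asum triple_scale_right scale_sum_right odd_power_Suc mult_ac)
    finally show ?case using Suc by simp
  qed simp
  have coeff: "real (N choose k) * h ^ k \<le> M * g ^ N" if k: "k \<le> N" for N k
  proof -
    have "norm ((of_nat (N choose k) * of_real h ^ k) *\<^sub>C ?c k) \<le> g ^ N"
    proof (rule coefficient_bound[OF _ k])
      fix \<zeta> :: complex assume \<zeta>: "cmod \<zeta> = 1"
      have "norm (((\<lambda>x. x + (h * \<zeta>) *\<^sub>C ?A x) ^^ N) w) \<le> g ^ N * norm w"
        by (rule norm_funpow_le[OF step[OF \<zeta>]]) (use g0 in simp)
      then show "norm (\<Sum>i\<le>N. \<zeta> ^ i *\<^sub>C (of_nat (N choose i) * of_real h ^ i) *\<^sub>C ?c i) \<le> g ^ N"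
        unfolding poly by (simp add: w power_mult_distrib mult_ac)
    qed
    then have "(real (N choose k) * h ^ k) * norm (?c k) \<le> g ^ N"
      using h0 by (simp add: norm_scaleC norm_mult norm_power)
    then have "M * ((real (N choose k) * h ^ k) * norm (?c k)) \<le> M * g ^ N"
      using M by (intro mult_left_mono) auto
    moreover have "(real (N choose k) * h ^ k) * 1 \<le> (real (N choose k) * h ^ k) * (M * norm (?c k))"
      unfolding M_def using norm_odd_power_ge[OF w, of k] h0 by (intro mult_left_mono) auto
    ultimately show ?thesis by (simp add: mult_ac)
  qed
  define q where "q = g / (1 + h)"
  have q: "0 < q" "q < 1" using g0 gh h0 by (simp_all add: q_def)
  have bound: "1 \<le> (M * real (N + 1)) * q ^ N" for N
  proof -
    have "(1 + h) ^ N = (\<Sum>k\<le>N. real (N choose k) * h ^ k)"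
      using binomial_ring[of h 1 N] by (simp add: add.commute)
    also have "\<dots> \<le> (\<Sum>k\<le>N. M * g ^ N)" by (rule sum_mono) (use coeff in simp)
    also have "\<dots> = (M * real (N + 1)) * g ^ N" by simp
    finally have "(1 + h) ^ N \<le> (M * real (N + 1)) * g ^ N" .
    then show ?thesis using h0 by (simp add: q_def power_divide pos_le_divide_eq)
  qed
  have "(\<lambda>N. M * (real N * q ^ N) + M * q ^ N) \<longlonglongrightarrow> M * 0 + M * 0"
    using q by (intro tendsto_intros powser_times_n_limit_0 LIMSEQ_power_zero) auto
  then have "(\<lambda>N. (M * real (N + 1)) * q ^ N) \<longlonglongrightarrow> 0" by (simp add: algebra_simps)
  then have "1 \<le> (0::real)"
    by (rule tendsto_lowerbound) (use bound in auto)
  then show False by simp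
qed

lemma eq_1_of_Re_ge_1:
  fixes c :: complex
  assumes "cmod c \<le> 1" "1 \<le> Re c"
  shows "c = 1"
proof -
  have "Re c = 1" using assms complex_Re_le_cmod[of c] by linarith
  moreover have "(cmod c)\<^sup>2 \<le> 1" using assms(1) by (simp add: power_le_one)
  ultimately show ?thesis by (simp add: cmod_power2 complex_eq_iff)
qed

text \<open>With \<open>y = (z + z\<^sup>5) / 2\<close> and \<open>d = (z - z\<^sup>5) / 2\<close> one has \<open>L(y, y) = L(z\<^sup>3, z\<^sup>3) + L(d, d)\<close>, because
  \<open>((t + t\<^sup>5) / 2)\<^sup>2 = (t\<^sup>3)\<^sup>2 + ((t - t\<^sup>5) / 2)\<^sup>2\<close>.  So \<open>\<parallel>y\<parallel> \<ge> \<parallel>z\<^sup>3\<parallel> = 1\<close>, and a functional supporting at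
  \<open>y\<close> has the value 1 at both \<open>z\<close> and \<open>z\<^sup>5\<close>.\<close>

lemma ex_supports_fifth_power:
  assumes z: "norm z = 1"
  shows "\<exists>\<phi>. supports \<phi> z \<and> \<phi> (odd_power z 2) = 1"
proof -
  let ?c = "odd_power z"
  define y d where "y = (1/2) *\<^sub>R (z + ?c 2)" and "d = (1/2) *\<^sub>R (z - ?c 2)"
  have w: "norm (?c 1) = 1"
    using norm_odd_power_cube[of z 0] z by simp
  have split: "triple y y x = triple (?c 1) (?c 1) x + triple d d x" for x
  proof -
    have F: "triple z (?c 2) x = triple (?c 2) z x"
      "triple (?c 2) (?c 2) x = triple (?c 4) z x" "triple (?c 1) (?c 1) x = triple (?c 2) z x"
      using odd_power_box[of z 0 2 x] odd_power_box[of z 2 2 x] odd_power_box[of z 1 1 x]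
      by (simp_all add: numeral_2_eq_2[symmetric])
    define p q r where "p = triple z z x" and "q = triple (?c 2) z x" and "r = triple (?c 4) z x"
    have "triple y y x = (1/2) *\<^sub>R (1/2) *\<^sub>R ((p + q) + (q + r))"
      and "triple d d x = (1/2) *\<^sub>R (1/2) *\<^sub>R ((p - q) - (q - r))"
      by (simp_all only: y_def d_def triple_scaleR triple_add_left triple_add_middle
          triple_diff(1,2) F p_def q_def r_def scaleR_add_right scaleR_right_diff_distrib)
    moreover have "(p + q) + (q + r) = 2 *\<^sub>R (2 *\<^sub>R q) + ((p - q) - (q - r))"
      unfolding scaleR_2 by simp
    ultimately have "triple y y x = (1/2) *\<^sub>R (1/2) *\<^sub>R (2 *\<^sub>R (2 *\<^sub>R q)) + triple d d x"
      by (simp only: scaleR_add_right)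
    then show ?thesis unfolding F(3) q_def[symmetric] by simp
  qed
  have "1 \<le> norm y"
  proof -
    have "1 \<le> (norm y)\<^sup>2"
    proof (rule numerical_range_reaches_norm[OF w])
      fix \<phi> x assume \<phi>: "supports \<phi> x"
      show "Re (\<phi> (triple (?c 1) (?c 1) x)) \<le> (norm y)\<^sup>2 * norm x"
        using box_le[OF \<phi>, of y] box_nonneg[OF \<phi>, of d] by (simp add: split supports_add[OF \<phi>])
    qed simp
    then show ?thesis using power2_le_imp_le[of 1 "norm y"] by simp
  qed
  then have two: "2 \<le> norm (z + ?c 2)" by (simp add: y_def)
  obtain \<phi> where \<phi>: "supports \<phi> (z + ?c 2)" using ex_supports by blast
  have b: "cmod (\<phi> z) \<le> 1" "cmod (\<phi> (?c 2)) \<le> 1"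
    using supports_bound[OF \<phi>, of z] supports_bound[OF \<phi>, of "?c 2"] z
      norm_odd_power_le_1[of z 2] by simp_all
  have "2 \<le> Re (\<phi> z) + Re (\<phi> (?c 2))"
    using two supports_self[OF \<phi>] by (simp add: supports_add[OF \<phi>] complex_eq_iff)
  moreover have "Re (\<phi> z) \<le> 1" "Re (\<phi> (?c 2)) \<le> 1"
    using b complex_Re_le_cmod[of "\<phi> z"] complex_Re_le_cmod[of "\<phi> (?c 2)"] by linarith+
  ultimately have "1 \<le> Re (\<phi> z)" "1 \<le> Re (\<phi> (?c 2))" by linarith+
  then have "\<phi> z = 1" "\<phi> (?c 2) = 1" using b eq_1_of_Re_ge_1 by blast+
  then show ?thesis using \<phi> z by (intro exI[of _ \<phi>]) (simp add: supports_def)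
qed

section \<open>Supporting functionals in a JB*-triple\<close>

text \<open>Polarisation of the fact that all \<open>\<phi> {a, a, z}\<close> are real.\<close>

lemma form_hermitian:
  assumes \<phi>: "supports \<phi> z"
  shows "\<phi> (triple b a z) = cnj (\<phi> (triple a b z))"
proof -
  let ?f = "\<lambda>a b. \<phi> (triple a b z)"
  have real: "Im (?f a a) = 0" for a by (rule box_real[OF \<phi>])
  have "?f (a + b) (a + b) = ?f a a + ?f a b + ?f b a + ?f b b"
    by (simp add: triple_add_left triple_add_middle supports_add[OF \<phi>])
  then have 1: "Im (?f a b) + Im (?f b a) = 0"
    using real[of "a + b"] real[of a] real[of b] by simp
  have "?f (a + \<i> *\<^sub>C b) (a + \<i> *\<^sub>C b) = ?f a a - \<i> * ?f a b + \<i> * ?f b a + ?f b b"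
    by (simp add: triple_add_left triple_add_middle triple_scale_left triple_scale_middle
        supports_add[OF \<phi>] supports_diff[OF \<phi>] supports_scaleC[OF \<phi>] complex_eq_iff)
  then have 2: "- Re (?f a b) + Re (?f b a) = 0"
    using real[of "a + \<i> *\<^sub>C b"] real[of a] real[of b] by simp
  show ?thesis using 1 2 by (simp add: complex_eq_iff)
qed

text \<open>The Cauchy--Schwarz inequality for the positive form \<open>(a, b) \<mapsto> \<phi> {a, b, z}\<close>, in the only case that
  matters here.\<close>

lemma form_null:
  assumes \<phi>: "supports \<phi> z" and d: "\<phi> (triple d d z) = 0"
  shows "\<phi> (triple x d z) = 0" "\<phi> (triple d x z) = 0"
proof -
  let ?f = "\<lambda>a b. \<phi> (triple a b z)"
  define p where "p = ?f x d"
  have q: "?f d x = cnj p" unfolding p_def by (rule form_hermitian[OF \<phi>])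
  define P where "P = Re p * Re p + Im p * Im p"
  have ineq: "0 \<le> Re (?f x x) - 2 * t * P" for t :: real
  proof -
    define c where "c = - of_real t * p"
    have "?f (x + c *\<^sub>C d) (x + c *\<^sub>C d) = ?f x x + cnj c * p + c * cnj p"
      by (simp add: triple_add_left triple_add_middle triple_scale_left triple_scale_middle
          supports_add[OF \<phi>] supports_scaleC[OF \<phi>] d q p_def[symmetric])
    moreover have "0 \<le> Re (?f (x + c *\<^sub>C d) (x + c *\<^sub>C d))" by (rule box_nonneg[OF \<phi>])
    ultimately have "0 \<le> Re (?f x x + cnj c * p + c * cnj p)" by simp
    then show ?thesis by (simp add: c_def P_def algebra_simps)
  qed
  have "P = 0"
  proof (rule ccontr)
    assume "P \<noteq> 0"
    then show False using ineq[of "(Re (?f x x) + 1) / (2 * P)"] by simp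
  qed
  then have "p = 0" by (simp add: P_def complex_eq_iff sum_squares_eq_zero_iff)
  then show "\<phi> (triple x d z) = 0" "\<phi> (triple d x z) = 0" using q by (simp_all add: p_def)
qed

text \<open>For \<open>\<phi>\<close> with \<open>\<phi> z = \<phi> z\<^sup>5 = 1\<close> the element \<open>z - z\<^sup>3\<close> is null for the form, which makes
  \<open>\<phi> \<circ> L(z, z)\<close> invariant under \<open>L(z, z)\<close>. It has norm at most 1 because the
  operators \<open>\<lambda> (\<lambda> + 1 - L(z, z))\<^sup>-\<^sup>1\<close> are contractions and their composites with \<open>\<phi>\<close> tend to
  \<open>\<phi> \<circ> L(z, z)\<close> as \<open>\<lambda> \<rightarrow> 0\<close>.\<close>

lemma ex_invariant_supports:
  assumes z: "norm z = 1"
  shows "\<exists>\<phi>. supports \<phi> z \<and> (\<forall>x. \<phi> (triple z z x) = \<phi> x)"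
proof -
  let ?c = "odd_power z" and ?L = "triple z z" and ?Q = "\<lambda>x. triple z x z"
  obtain \<phi> where \<phi>: "supports \<phi> z" and five: "\<phi> (?c 2) = 1"
    using ex_supports_fifth_power[OF z] by blast
  note lin = supports_add[OF \<phi>] supports_diff[OF \<phi>] supports_scaleR[OF \<phi>]
  define d where "d = z - ?c 1"
  have c: "cmod (\<phi> (?c k)) \<le> 1" for k
    using supports_bound[OF \<phi>, of "?c k"] norm_odd_power_le_1[of z k] z by simp
  have dd: "\<phi> (triple d d z) = \<phi> (?c 1) + \<phi> (?c 3) - 2"
  proof -
    have t: "triple z z z = ?c 1" "triple z (?c 1) z = ?c 2" "triple (?c 1) z z = ?c 2"
      "triple (?c 1) (?c 1) z = ?c 3"
      using triple_odd_power[of z 0 0 0] triple_odd_power[of z 0 1 0] triple_odd_power[of z 1 0 0]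
        triple_odd_power[of z 1 1 0] by (simp_all add: numeral_2_eq_2 numeral_3_eq_3)
    show ?thesis unfolding d_def triple_diff t lin five by simp
  qed
  have "0 \<le> Re (\<phi> (?c 1)) + Re (\<phi> (?c 3)) - 2" using box_nonneg[OF \<phi>, of d] by (simp add: dd)
  moreover have "Re (\<phi> (?c k)) \<le> 1" for k
    using c[of k] complex_Re_le_cmod[of "\<phi> (?c k)"] by linarith
  ultimately have "1 \<le> Re (\<phi> (?c 1))" "1 \<le> Re (\<phi> (?c 3))"
    by (smt (verit))+
  then have c13: "\<phi> (?c 1) = 1" "\<phi> (?c 3) = 1" using c eq_1_of_Re_ge_1 by blast+
  then have null: "\<phi> (triple d d z) = 0" by (simp add: dd)
  have cube: "\<phi> (triple x (?c 1) z) = \<phi> (?L x)" for x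
    using form_null(1)[OF \<phi> null, of x] by (simp add: d_def triple_diff lin triple_commute[of z z x])
  have Q: "\<phi> (?Q x) = cnj (\<phi> (?L x))" for x
    using form_hermitian[OF \<phi>, of z x] by (simp add: triple_commute[of z z x])
  have idem: "\<phi> (?L (?L x)) = \<phi> (?L x)" for x
  proof -
    have LQ: "?L (?Q x) = ?Q (?L x)"
      using quad_box_power[of z 1 x] by (simp add: box_power_Suc)
    have "2 *\<^sub>R ?L (?L x) = triple (?c 1) z x + ?Q (?Q x)"
      using box_power_recurrence[of z 0 x] by (simp add: box_power_Suc quad_sq_def)
    then have "2 * \<phi> (?L (?L x)) = \<phi> (triple (?c 1) z x) + \<phi> (?Q (?Q x))"
      using lin by (metis of_real_numeral)
    also have "triple (?c 1) z x = triple x (?c 1) z"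
      using odd_power_box_0[of z 1 x] by (simp add: triple_commute[of x])
    also have "\<phi> (?Q (?Q x)) = \<phi> (?L (?L x))" unfolding Q LQ by simp
    finally show ?thesis using cube[of x] by simp
  qed
  have bound: "cmod (\<phi> (?L x)) \<le> norm x" for x
  proof (rule field_le_epsilon)
    fix e :: real assume e: "0 < e"
    define l where "l = e / (2 * norm x + 1)"
    have l: "0 < l" using e by (simp add: l_def add_nonneg_pos)
    obtain y where y: "(1 + l) *\<^sub>R y - ?L y = l *\<^sub>R x"
      using box_invertible_above[OF z, of "1 + l"] l by auto
    have ny: "norm y \<le> norm x"
    proof -
      obtain \<psi> where \<psi>: "supports \<psi> y" using ex_supports by blast
      have "(1 + l) * norm y - Re (\<psi> (?L y)) = l * Re (\<psi> x)"
        using arg_cong[OF y, of "\<lambda>u. Re (\<psi> u)"]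
        by (simp add: supports_diff[OF \<psi>] supports_scaleR[OF \<psi>] supports_self[OF \<psi>])
      moreover have "Re (\<psi> (?L y)) \<le> norm y" using box_le[OF \<psi>, of z] z by simp
      moreover have "l * Re (\<psi> x) \<le> l * norm x"
        using l supports_Re_le[OF \<psi>, of x] by simp
      ultimately have "l * norm y \<le> l * norm x" by (simp add: distrib_right)
      then show ?thesis using l by simp
    qed
    have "(1 + l) * \<phi> (?L y) - \<phi> (?L (?L y)) = l * \<phi> (?L x)"
      using arg_cong[OF y, of "\<lambda>u. \<phi> (?L u)"] by (simp add: triple_linear lin)
    then have "of_real l * \<phi> (?L y) = of_real l * \<phi> (?L x)" by (simp add: idem algebra_simps)
    then have Ly: "\<phi> (?L y) = \<phi> (?L x)" using l by simp
    have "(1 + l) * \<phi> y - \<phi> (?L y) = l * \<phi> x"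
      using arg_cong[OF y, of \<phi>] by (simp add: lin)
    then have "\<phi> (?L x) = (1 + l) * \<phi> y - l * \<phi> x" by (simp add: Ly algebra_simps)
    then have "cmod (\<phi> (?L x)) \<le> cmod ((1 + l) * \<phi> y) + cmod (l * \<phi> x)"
      by (metis norm_triangle_ineq4)
    also have "\<dots> = (1 + l) * cmod (\<phi> y) + l * cmod (\<phi> x)"
      using l norm_of_real[of "1 + l", where 'a = complex] by (simp add: norm_mult)
    also have "\<dots> \<le> (1 + l) * norm x + l * norm x"
      using l ny supports_bound[OF \<phi>, of y] supports_bound[OF \<phi>, of x]
      by (intro add_mono mult_left_mono) auto
    also have "\<dots> \<le> norm x + l * (2 * norm x + 1)" using l by (simp add: algebra_simps)
    also have "l * (2 * norm x + 1) = e"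
      using add_nonneg_pos[of "2 * norm x" 1] by (simp add: l_def)
    finally show "cmod (\<phi> (?L x)) \<le> norm x + e" .
  qed
  have "supports (\<lambda>x. \<phi> (?L x)) z"
    unfolding supports_def
    using bound c13(1) z by (simp add: triple_linear triple_scale_right lin supports_scaleC[OF \<phi>] odd_power_Suc)
  then show ?thesis using idem by (intro exI[of _ "\<lambda>x. \<phi> (?L x)"]) simp
qed

text \<open>The vector field \<open>\<parallel>w\<parallel>\<^sup>2 a - {w, a, w}\<close> is tangent to all spheres; on the unit sphere it is the
  field \<open>a - {w, a, w}\<close> whose flow consists of automorphisms of the open unit ball. The invariant
  functional at each point has an imaginary value on the field, and the inward criterion, applied to the field
  and its negative, passes this on to every supporting functional.\<close>

theorem supports_quadratic:
  assumes \<phi>: "supports \<phi> z"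
  shows "\<phi> (triple z a z) = (norm z)\<^sup>2 * cnj (\<phi> a)"
proof -
  have re: "Re (\<phi> (triple z a z)) = (norm z)\<^sup>2 * Re (\<phi> a)" for a
  proof -
    define X where "X w = (norm w)\<^sup>2 *\<^sub>R a - triple w a w" for w
    have tan: "\<exists>\<psi>. supports \<psi> w \<and> Re (\<psi> (X w)) = 0" for w
    proof (cases "w = 0")
      case True
      obtain \<psi> where "supports \<psi> w" using ex_supports by blast
      then show ?thesis using True by (auto simp: X_def triple_zero supports_zero)
    next
      case False
      define v where "v = inverse (norm w) *\<^sub>R w"
      have v: "norm v = 1" "w = norm w *\<^sub>R v" using False by (simp_all add: v_def)
      obtain \<psi> where \<psi>: "supports \<psi> v" "\<And>x. \<psi> (triple v v x) = \<psi> x"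
        using ex_invariant_supports[OF v(1)] by blast
      have "supports \<psi> w"
        using supports_positive_multiple[OF \<psi>(1), of "norm w"] False v(2) by simp
      moreover have "Re (\<psi> (X w)) = 0"
      proof -
        have "triple w a w = (norm w)\<^sup>2 *\<^sub>R triple v a v"
          by (subst (1 2) v(2)) (simp add: triple_scaleR power2_eq_square)
        moreover have "\<psi> (triple v a v) = cnj (\<psi> a)"
          using form_hermitian[OF \<psi>(1), of v a] \<psi>(2)[of a] by (simp add: triple_commute[of a v v])
        ultimately show ?thesis
          by (simp add: X_def supports_diff[OF \<psi>(1)] supports_scaleR[OF \<psi>(1)])
      qed
      ultimately show ?thesis by blast
    qed
    define M where "M = triple_const"
    have M: "1 \<le> M" by (simp add: M_def triple_const_ge_1)
    define C where "C = (2 * norm z + 1) * (norm a + M * norm a)"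
    have lip: "norm (X w - X z) \<le> C * norm (w - z)" if w: "norm (w - z) \<le> 1" for w
    proof -
      have nw: "norm w \<le> norm z + 1" using norm_triangle_sub[of w z] w by linarith
      let ?u = "((norm w)\<^sup>2 - (norm z)\<^sup>2) *\<^sub>R a"
        and ?v1 = "triple (w - z) a w" and ?v2 = "triple z a (w - z)"
      have "X w - X z = ?u - (?v1 + ?v2)"
        by (simp add: X_def triple_diff scaleR_left_diff_distrib)
      moreover have "norm (?u - (?v1 + ?v2)) \<le> norm ?u + (norm ?v1 + norm ?v2)"
        using norm_triangle_ineq4[of ?u "?v1 + ?v2"] norm_triangle_ineq[of ?v1 ?v2] by linarith
      ultimately have "norm (X w - X z) \<le> norm ?u + (norm ?v1 + norm ?v2)" by simp
      also have "\<dots> \<le> (norm (w - z) * (2 * norm z + 1)) * norm a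
          + (M * norm (w - z) * norm a * (norm z + 1) + M * norm z * norm a * norm (w - z))"
      proof (intro add_mono)
        have "\<bar>(norm w)\<^sup>2 - (norm z)\<^sup>2\<bar> = \<bar>norm w - norm z\<bar> * (norm w + norm z)"
        proof -
          have "(norm w)\<^sup>2 - (norm z)\<^sup>2 = (norm w - norm z) * (norm w + norm z)"
            by (simp add: power2_eq_square algebra_simps)
          then show ?thesis by (simp only: abs_mult) simp
        qed
        also have "\<dots> \<le> norm (w - z) * (2 * norm z + 1)"
          using nw by (intro mult_mono norm_triangle_ineq3) auto
        finally show "norm (((norm w)\<^sup>2 - (norm z)\<^sup>2) *\<^sub>R a) \<le> (norm (w - z) * (2 * norm z + 1)) * norm a"
          by (simp add: mult_right_mono)
        show "norm (triple (w - z) a w) \<le> M * norm (w - z) * norm a * (norm z + 1)"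
          unfolding M_def by (rule norm_triple_le') (use nw in auto)
        show "norm (triple z a (w - z)) \<le> M * norm z * norm a * norm (w - z)"
          unfolding M_def by (rule norm_triple_le)
      qed
      also have "\<dots> = C * norm (w - z)" by (simp add: C_def algebra_simps)
      finally show ?thesis .
    qed
    have "Re (\<phi> (X z)) \<le> 0"
      by (rule inward_for_all_supports[OF _ lip \<phi>]) (metis tan order_refl)
    moreover have "Re (\<phi> (- X z)) \<le> 0"
    proof (rule inward_for_all_supports[OF _ _ \<phi>, where C = C])
      show "\<exists>\<psi>. supports \<psi> w \<and> Re (\<psi> (- X w)) \<le> 0" for w
        using tan[of w] by (auto simp: supports_minus)
      show "norm (- X w - - X z) \<le> C * norm (w - z)" if "norm (w - z) \<le> 1" for w
        using lip[OF that] norm_minus_commute[of "X w" "X z"] by simp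
    qed
    ultimately have "Re (\<phi> (X z)) = 0" by (simp add: supports_minus[OF \<phi>])
    then show ?thesis by (simp add: X_def supports_diff[OF \<phi>] supports_scaleR[OF \<phi>])
  qed
  have "Im (\<phi> (triple z a z)) = - (norm z)\<^sup>2 * Im (\<phi> a)"
    using re[of "\<i> *\<^sub>C a"]
    by (simp add: triple_scale_middle supports_scaleC[OF \<phi>] supports_minus[OF \<phi>])
  with re[of a] show ?thesis by (simp add: complex_eq_iff)
qed

lemma supports_box_self:
  fixes \<phi> :: "'a \<Rightarrow> complex"
  assumes "supports \<phi> z"
  shows "\<phi> (triple z z a) = (norm z)\<^sup>2 * \<phi> a"
  using form_hermitian[OF assms, of a z] supports_quadratic[OF assms, of a]
  by (simp add: triple_commute[of z z a])

end

context jb_star_triple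
begin

section \<open>Local triple derivations are dissipative in both directions\<close>

text \<open>On the elements occurring in the Leibniz rule, \<open>\<phi>\<close> does not distinguish \<open>u\<^sub>n\<close> from \<open>u\<close>, because
  \<open>u - u\<^sub>n\<close> is null for the form of \<open>\<phi>\<close>. So each power contributes one more \<open>\<phi> (\<delta> u)\<close> and one more
  conjugate of it.\<close>

lemma triple_derivation_at_odd_powers:
  assumes \<delta>: "triple_derivation scaleC triple \<delta>" and \<phi>: "supports \<phi> u" and u: "norm u = 1"
  shows "\<phi> (\<delta> (odd_power u n)) = of_nat (n + 1) * \<phi> (\<delta> u) + of_nat n * cnj (\<phi> (\<delta> u))"
proof (induction n)
  case (Suc n)
  let ?c = "odd_power u"
  have Q: "\<phi> (triple u x u) = cnj (\<phi> x)" for x using supports_quadratic[OF \<phi>, of x] u by simp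
  have L: "\<phi> (triple u u x) = \<phi> x" for x using supports_box_self[OF \<phi>, of x] u by simp
  have c1: "\<phi> (?c k) = 1" for k
    by (induction k) (simp_all add: odd_power_Suc L supports_self[OF \<phi>] u)
  define d where "d = u - ?c n"
  have "\<phi> (triple d d u) = 0"
  proof -
    have t: "triple u u u = ?c 1" "triple u (?c n) u = ?c (n + 1)" "triple (?c n) u u = ?c (n + 1)"
      "triple (?c n) (?c n) u = ?c (n + n + 1)"
      using triple_odd_power[of u 0 0 0] triple_odd_power[of u 0 n 0] triple_odd_power[of u n 0 0]
        triple_odd_power[of u n n 0] by simp_all
    show ?thesis unfolding d_def triple_diff t supports_diff[OF \<phi>] c1 by simp
  qed
  note null = form_null[OF \<phi> this]
  have outer: "\<phi> (triple x u (?c n)) = \<phi> x" for x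
  proof -
    have "triple x u (?c n) = triple x (?c n) u"
      using odd_power_box_0[of u n x]
      by (simp only: triple_commute[of x u "?c n"] triple_commute[of x "?c n" u])
    moreover have "\<phi> (triple x (?c n) u) = \<phi> (triple x u u)"
      using null(1)[of x] by (simp add: d_def triple_diff supports_diff[OF \<phi>])
    ultimately show ?thesis by (simp add: triple_commute[of x u u] L)
  qed
  have inner: "\<phi> (triple u x (?c n)) = cnj (\<phi> x)" for x
    using null(2)[of x] Q[of x]
    by (simp add: d_def triple_diff supports_diff[OF \<phi>] triple_commute[of u x "?c n"])
  have "\<delta> (?c (Suc n)) = triple (\<delta> u) u (?c n) + triple u (\<delta> u) (?c n) + triple u u (\<delta> (?c n))"
    using \<delta> by (simp add: odd_power_Suc triple_derivation_def)
  then have "\<phi> (\<delta> (?c (Suc n))) = \<phi> (\<delta> u) + cnj (\<phi> (\<delta> u)) + \<phi> (\<delta> (?c n))"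
    by (simp add: supports_add[OF \<phi>] outer inner L)
  then show ?case by (simp add: Suc algebra_simps)
qed simp

text \<open>By the previous lemma, \<open>\<phi> (\<delta> y)\<close> for a real combination \<open>y = \<Sum> q\<^sub>k u\<^sub>k\<close> of odd powers depends
  only on \<open>\<Sum> q\<^sub>k\<close> and \<open>\<Sum> k q\<^sub>k\<close>. If both are zero, then \<open>\<phi> (T y) = 0\<close>; such \<open>y\<close> approximate
  \<open>u\<^sup>3 - u\<close>, so \<open>\<phi> (T u\<^sup>3) = \<phi> (T u)\<close> as \<open>T\<close> is bounded. For \<open>h = 3 u - u\<^sup>3\<close> the value \<open>\<phi> (\<delta> h)\<close> is
  imaginary, and so is \<open>2 \<phi> (T u) = \<phi> (T h)\<close>.\<close>

lemma local_triple_derivation_skew: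
  assumes T: "local_triple_derivation scaleC triple T" and bT: "bounded_clinear scaleC T"
    and \<phi>: "supports \<phi> b"
  shows "Re (\<phi> (T b)) = 0"
proof (cases "b = 0")
  case True
  then show ?thesis using bounded_clinearD(5)[OF bT] supports_zero[OF \<phi>] by simp
next
  case False
  define u where "u = inverse (norm b) *\<^sub>R b"
  have u: "norm u = 1" using False by (simp add: u_def)
  have \<phi>u: "supports \<phi> u" unfolding u_def
    by (rule supports_positive_multiple[OF \<phi>]) (use False in simp)
  note lin = supports_add[OF \<phi>] supports_diff[OF \<phi>] supports_scaleR[OF \<phi>]
  note TD = bounded_clinearD[OF bT]
  let ?c = "odd_power u"
  have deriv: "\<exists>\<delta>. triple_derivation scaleC triple \<delta> \<and> T a = \<delta> a" for a
    using T by (simp add: local_triple_derivation_def)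
  have \<delta>lin: "\<delta> (x + y) = \<delta> x + \<delta> y" "\<delta> (x - y) = \<delta> x - \<delta> y" "\<delta> (r *\<^sub>R x) = r *\<^sub>R \<delta> x"
    if "triple_derivation scaleC triple \<delta>" for \<delta> x y r
  proof -
    have l: "Vector_Spaces.linear scaleC scaleC \<delta>" using that by (simp add: triple_derivation_def)
    then have a: "\<delta> (x + y) = \<delta> x + \<delta> y" for x y by (simp add: Vector_Spaces.linear_iff)
    show "\<delta> (x + y) = \<delta> x + \<delta> y" by (rule a)
    show "\<delta> (x - y) = \<delta> x - \<delta> y" using a[of "x - y" y] by simp
    show "\<delta> (r *\<^sub>R x) = r *\<^sub>R \<delta> x"
      using l by (simp add: scaleR_eq_scaleC Vector_Spaces.linear_iff)
  qed
  obtain K where K: "0 < K" "\<And>x. norm (T x) \<le> K * norm x" using TD(7) by blast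
  have eq: "\<phi> (T (?c 1 - ?c 0)) = of_real (1 / real N) * \<phi> (T (?c (N + 1) - ?c 1))"
    if N: "0 < N" for N
  proof -
    define y where "y = (?c 1 - ?c 0) - (1 / real N) *\<^sub>R (?c (N + 1) - ?c 1)"
    obtain \<delta> where \<delta>: "triple_derivation scaleC triple \<delta>" "T y = \<delta> y" using deriv by blast
    have "\<phi> (\<delta> y) = 0"
      unfolding y_def \<delta>lin[OF \<delta>(1)] lin triple_derivation_at_odd_powers[OF \<delta>(1) \<phi>u u]
      using N by (simp add: field_simps)
    then have "\<phi> (T y) = 0" using \<delta>(2) by simp
    then show ?thesis unfolding y_def TD(3,4) lin by simp
  qed
  have "cmod (\<phi> (T (?c 1 - ?c 0))) \<le> 0"
  proof (rule tendsto_lowerbound)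
    show "(\<lambda>N. 2 * K / real N) \<longlonglongrightarrow> 0" by (rule lim_const_over_n)
    show "\<forall>\<^sub>F N in sequentially. cmod (\<phi> (T (?c 1 - ?c 0))) \<le> 2 * K / real N"
      using eventually_gt_at_top[of 0]
    proof eventually_elim
      case (elim N)
      have "norm (?c (N + 1) - ?c 1) \<le> 2"
        using norm_triangle_ineq4[of "?c (N + 1)" "?c 1"] norm_odd_power_le_1[of u "N + 1"]
          norm_odd_power_le_1[of u 1] u by simp
      then have "K * norm (?c (N + 1) - ?c 1) \<le> K * 2" using K by (intro mult_left_mono) auto
      then have "cmod (\<phi> (T (?c (N + 1) - ?c 1))) \<le> 2 * K"
        using supports_bound[OF \<phi>, of "T (?c (N + 1) - ?c 1)"] K(2)[of "?c (N + 1) - ?c 1"]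
        by linarith
      then have "(1 / real N) * cmod (\<phi> (T (?c (N + 1) - ?c 1))) \<le> (1 / real N) * (2 * K)"
        by (rule mult_left_mono) simp
      then show ?case unfolding eq[OF elim] norm_mult norm_of_real by simp
    qed
  qed simp
  then have c10: "\<phi> (T (?c 1)) = \<phi> (T u)" by (simp add: TD(3) lin)
  define h where "h = 3 *\<^sub>R ?c 0 - ?c 1"
  obtain \<delta> where \<delta>: "triple_derivation scaleC triple \<delta>" "T h = \<delta> h" using deriv by blast
  have "\<phi> (T h) = \<phi> (\<delta> u) - cnj (\<phi> (\<delta> u))"
    unfolding \<delta>(2) unfolding h_def \<delta>lin[OF \<delta>(1)] lin
      triple_derivation_at_odd_powers[OF \<delta>(1) \<phi>u u] by simp
  then have "Re (\<phi> (T h)) = 0" by simp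
  moreover have "\<phi> (T h) = 2 * \<phi> (T u)" by (simp add: h_def TD(3,4) lin c10[simplified])
  ultimately have "Re (\<phi> (T u)) = 0" by simp
  moreover have "T b = norm b *\<^sub>R T u" using False by (simp add: u_def TD(4))
  ultimately show ?thesis by (simp add: lin)
qed

section \<open>Isometries and their generators\<close>

text \<open>Kaup's theorem for an isometry \<open>U\<close> with inverse \<open>V\<close>: the difference of
  \<open>U {V z, a, V z}\<close> and \<open>{z, U a, z}\<close> is a quadratic field tangent to all spheres, because a functional
  supporting at \<open>z\<close> composed with \<open>U\<close> supports at \<open>V z\<close>.\<close>

theorem isometry_preserves_triple:
  assumes U: "bounded_clinear scaleC U" and V: "bounded_clinear scaleC V"
    and UV: "\<And>x. U (V x) = x" and VU: "\<And>x. V (U x) = x"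
    and iso: "\<And>x. norm (U x) = norm x"
  shows "U (triple x a y) = triple (U x) (U a) (U y)"
proof -
  note UD = bounded_clinearD[OF U] and VD = bounded_clinearD[OF V]
  have isoV: "norm (V x) = norm x" for x using iso[of "V x"] by (simp add: UV)
  define b where "b x y = U (triple (V x) a (V y)) - triple x (U a) y" for x y
  have zero: "b z z = 0" for z
  proof (rule tangential_quadratic_zero[where b = b])
    show "b (x + y) z = b x z + b y z" "b x (y + z) = b x y + b x z" for x y z
      by (simp_all add: b_def UD VD triple_linear)
    show "b (c *\<^sub>C x) y = c *\<^sub>C b x y" "b x (c *\<^sub>C y) = c *\<^sub>C b x y" for c x y
      by (simp_all add: b_def UD(2) VD(2) triple_scale_left triple_scale_right scale_right_diff_distrib)
    show "norm (b x y) \<le> (2 * triple_const * norm a) * norm x * norm y" for x y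
      using norm_triangle_ineq4[of "U (triple (V x) a (V y))" "triple x (U a) y"]
        norm_triple_le[of "V x" a "V y"] norm_triple_le[of x "U a" y]
      by (simp add: b_def iso isoV mult_ac)
    fix \<phi> z assume \<phi>: "supports \<phi> z"
    have "supports (\<lambda>x. \<phi> (U x)) (V z)"
      unfolding supports_def
      using supports_bound[OF \<phi>, of "U x" for x] supports_self[OF \<phi>]
      by (auto simp: UD(1,2) UV iso isoV supports_add[OF \<phi>] supports_scaleC[OF \<phi>])
    from supports_quadratic[OF this, of a]
    show "\<phi> (b z z) = 0"
      by (simp add: b_def supports_diff[OF \<phi>] supports_quadratic[OF \<phi>] isoV)
  qed
  have quad: "U (triple x a x) = triple (U x) (U a) (U x)" for x
    using zero[of "U x"] by (simp add: b_def VU)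
  have "triple (x + y) a (x + y) = triple x a x + 2 *\<^sub>R triple x a y + triple y a y"
    by (simp add: triple_linear scaleR_2 triple_commute[of y a x])
  moreover have "triple (U x + U y) (U a) (U x + U y)
      = triple (U x) (U a) (U x) + 2 *\<^sub>R triple (U x) (U a) (U y) + triple (U y) (U a) (U y)"
    by (simp add: triple_linear scaleR_2 triple_commute[of "U y" "U a" "U x"])
  ultimately have "2 *\<^sub>R U (triple x a y) = 2 *\<^sub>R triple (U x) (U a) (U y)"
    using quad[of "x + y"] quad[of x] quad[of y] by (simp add: UD(1,4))
  then show ?thesis by simp
qed

text \<open>The flow of such an operator consists of isometries in both time directions, hence of triple
  automorphisms; the difference quotients at time 0 satisfy a Leibniz rule in the limit.\<close>

lemma skew_operator_is_triple_derivation: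
  assumes T: "bounded_clinear scaleC T"
    and skew: "\<And>\<phi> x. supports \<phi> x \<Longrightarrow> Re (\<phi> (T x)) = 0"
  shows "T (triple x y z) = triple (T x) y z + triple x (T y) z + triple x y (T z)"
proof -
  note TD = bounded_clinearD[OF T]
  have bl: "bounded_linear T" using T by (simp add: bounded_clinear_def)
  obtain K where K: "0 < K" "\<And>x. norm (T x) \<le> K * norm x" using ex_norm_bound[OF bl] by blast
  have mT: "bounded_clinear scaleC (\<lambda>x. - T x)"
    by (rule bounded_clinearI[where K = K]) (simp_all add: TD(1,2) K(2))
  have le: "norm (flow T t x) \<le> norm x" for t x
  proof (cases "0 \<le> t")
    case True
    then show ?thesis by (intro flow_contractive[OF T]) (simp_all add: skew)
  next
    case False
    have "norm (flow (\<lambda>x. - T x) (- t) x) \<le> norm x"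
      using False by (intro flow_contractive[OF mT]) (simp_all add: skew supports_minus)
    then show ?thesis by (simp add: flow_def)
  qed
  have inv: "flow T t (flow T (- t) x) = x" for t x
    using flow_add[OF bl, of t "- t" x] flow_zero[OF bl] by simp
  have iso: "norm (flow T t x) = norm x" for t x
    using le[of t x] le[of "- t" "flow T t x"] inv[of "- t" x] by simp
  have hom: "flow T t (triple x y z) = triple (flow T t x) (flow T t y) (flow T t z)" for t x y z
    by (rule isometry_preserves_triple[where V = "flow T (- t)", OF flow_clinear[OF T] flow_clinear[OF T]])
      (use inv[of t] inv[of "- t"] iso in auto)
  define t where "t n = inverse (real (Suc n))" for n
  have t: "0 < t n" "t n \<le> 1" for n by (simp_all add: t_def inverse_le_1_iff)
  have t0: "t \<longlonglongrightarrow> 0" unfolding t_def[abs_def] by (rule LIMSEQ_inverse_real_of_nat)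
  define D where "D x n = inverse (t n) *\<^sub>R (flow T (t n) x - x)" for x n
  have D: "D x \<longlonglongrightarrow> T x" for x
  proof -
    have "(\<lambda>n. D x n - T x) \<longlonglongrightarrow> 0"
    proof (rule Lim_null_comparison)
      show "(\<lambda>n. t n * (K\<^sup>2 * exp K * norm x)) \<longlonglongrightarrow> 0" by (rule tendsto_mult_left_zero[OF t0])
      show "\<forall>\<^sub>F n in sequentially. norm (D x n - T x) \<le> t n * (K\<^sup>2 * exp K * norm x)"
      proof (rule always_eventually, rule allI)
        fix n
        have "D x n - T x = inverse (t n) *\<^sub>R (flow T (t n) x - x - t n *\<^sub>R T x)"
          using t(1)[of n] by (simp add: D_def scaleR_right_diff_distrib)
        then have "norm (D x n - T x) = inverse (t n) * norm (flow T (t n) x - x - t n *\<^sub>R T x)"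
          using t(1)[of n] by simp
        also have "\<dots> \<le> inverse (t n) * ((\<bar>t n\<bar> * K)\<^sup>2 * exp (\<bar>t n\<bar> * K) * norm x)"
          using t(1)[of n] K by (intro mult_left_mono flow_first_order) auto
        also have "\<dots> \<le> inverse (t n) * ((\<bar>t n\<bar> * K)\<^sup>2 * exp K * norm x)"
          using t[of n] K by (intro mult_left_mono mult_right_mono) auto
        also have "\<dots> = t n * (K\<^sup>2 * exp K * norm x)"
          using t(1)[of n] by (simp add: power2_eq_square field_simps)
        finally show "norm (D x n - T x) \<le> t n * (K\<^sup>2 * exp K * norm x)" .
      qed
    qed
    then show ?thesis by (simp add: LIM_zero_iff)
  qed
  have U: "(\<lambda>n. flow T (t n) x) \<longlonglongrightarrow> x" for x
  proof -
    have "(\<lambda>n. x + t n *\<^sub>R D x n) \<longlonglongrightarrow> x + 0 *\<^sub>R T x" by (intro tendsto_intros t0 D)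
    moreover have "x + t n *\<^sub>R D x n = flow T (t n) x" for n
      using t(1)[of n] by (simp add: D_def)
    ultimately show ?thesis by simp
  qed
  have lim: "(\<lambda>n. triple (f n) (g n) (h n)) \<longlonglongrightarrow> triple a b c"
    if "f \<longlonglongrightarrow> a" "g \<longlonglongrightarrow> b" "h \<longlonglongrightarrow> c" for f g h a b c
  proof -
    have "(\<lambda>n. (f n, g n, h n)) \<longlonglongrightarrow> (a, b, c)" by (intro tendsto_Pair that)
    then have "(\<lambda>n. case (f n, g n, h n) of (x, y, z) \<Rightarrow> triple x y z)
        \<longlonglongrightarrow> (case (a, b, c) of (x, y, z) \<Rightarrow> triple x y z)"
      by (rule continuous_on_tendsto_compose[OF triple_continuous]) auto
    then show ?thesis by simp
  qed
  have "D (triple x y z) = (\<lambda>n. triple (D x n) (flow T (t n) y) (flow T (t n) z)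
      + triple x (D y n) (flow T (t n) z) + triple x y (D z n))"
    by (rule ext)
      (simp only: D_def hom triple_scaleR triple_diff scaleR_add_right[symmetric] diff_add_cancel
        add_diff_eq diff_add_eq)
  moreover have "(\<lambda>n. triple (D x n) (flow T (t n) y) (flow T (t n) z)
      + triple x (D y n) (flow T (t n) z) + triple x y (D z n))
      \<longlonglongrightarrow> triple (T x) y z + triple x (T y) z + triple x y (T z)"
    by (intro tendsto_add lim D U tendsto_const)
  ultimately have "D (triple x y z) \<longlonglongrightarrow> triple (T x) y z + triple x (T y) z + triple x y (T z)"
    by simp
  with D[of "triple x y z"] show ?thesis by (rule LIMSEQ_unique)
qed

end

theorem theorem2p4:
  fixes scaleC :: "complex \<Rightarrow> 'a::banach \<Rightarrow> 'a"
    and triple :: "'a \<Rightarrow> 'a \<Rightarrow> 'a \<Rightarrow> 'a"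
    and T :: "'a \<Rightarrow> 'a"
  assumes "jb_star_triple scaleC triple"
    and "local_triple_derivation scaleC triple T"
    and "bounded_clinear scaleC T"
  shows "triple_derivation scaleC triple T"
proof -
  interpret jb_star_triple scaleC triple by (rule assms(1))
  have "T (triple x y z) = triple (T x) y z + triple x (T y) z + triple x y (T z)" for x y z
    by (rule skew_operator_is_triple_derivation[OF assms(3)])
      (rule local_triple_derivation_skew[OF assms(2,3)])
  then show ?thesis using assms(3) by (simp add: triple_derivation_def bounded_clinear_def)
qed

end
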